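(* Let $G$ be a graph with maximum degree $\Delta(G) \le 4$ and let $M$ be a matching in $G$ (viewed as a spanning subgraph of $G$). Then for every integer $\lambda \ge 3$ it holds that $BBC_\lambda(G, M) \le \lambda + 3$. Moreover, a $\lambda$-backbone $(\lambda+3)$-coloring of $G$ with backbone $M$ can be found in $\mathcal{O}(n)$ time, where $n = |V(G)|$.
   Context: Let $\lambda \ge 2$ be an integer. For a graph $G$ and a spanning subgraph $H$ of $G$ (the backbone; so $E(H) \subseteq E(G)$), a $\lambda$-backbone coloring of $G$ with backbone $H$ is a function $c\colon V(G) \to \mathbb{N}_+$ such that $c(u) \ne c(v)$ for every edge $\{u,v\} \in E(G)$ and $|c(u) - c(v)| \ge \lambda$ for every edge $\{u,v\} \in E(H)$. It is a $\lambda$-backbone $k$-coloring if all its colors lie in $\{1, \ldots, k\}$. $BBC_\lambda(G, H)$ denotes the smallest $k$ for which a $\lambda$-backbone $k$-coloring of $G$ with backbone $H$ exists. *)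

theory Defs
  imports Complex_Main "HOL-Library.Landau_Symbols"
begin

section \<open>Graphs and backbone colorings\<close>

record 'a graph =
  verts :: "'a set"
  edges :: "'a set set"

definition is_graph :: "'a graph \<Rightarrow> bool" where
  "is_graph G \<longleftrightarrow> finite (verts G) \<and>
     edges G \<subseteq> {{u, v} | u v. u \<in> verts G \<and> v \<in> verts G \<and> u \<noteq> v}"

definition degree :: "'a graph \<Rightarrow> 'a \<Rightarrow> nat" where
  "degree G v = card {e \<in> edges G. v \<in> e}"

(* The 0 only matters for the graph without vertices, where Max {} would be unspecified. *)
definition max_degree :: "'a graph \<Rightarrow> nat" where
  "max_degree G = Max (insert 0 (degree G ` verts G))"

definition spanning_subgraph :: "'a graph \<Rightarrow> 'a graph \<Rightarrow> bool" where
  "spanning_subgraph H G \<longleftrightarrow> is_graph H \<and> verts H = verts G \<and> edges H \<subseteq> edges G"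

definition matching :: "'a graph \<Rightarrow> 'a set set \<Rightarrow> bool" where
  "matching G M \<longleftrightarrow> M \<subseteq> edges G \<and> pairwise disjnt M"

definition spanned_by :: "'a graph \<Rightarrow> 'a set set \<Rightarrow> 'a graph" where
  "spanned_by G M = \<lparr>verts = verts G, edges = M\<rparr>"

lemma spanning_subgraph_matching:
  "is_graph G \<Longrightarrow> matching G M \<Longrightarrow> spanning_subgraph (spanned_by G M) G"
  by (auto simp: is_graph_def matching_def spanning_subgraph_def spanned_by_def)

(* Only the values of c on the vertices of G are relevant. *)
definition backbone_coloring :: "nat \<Rightarrow> 'a graph \<Rightarrow> 'a graph \<Rightarrow> ('a \<Rightarrow> nat) \<Rightarrow> bool" where
  "backbone_coloring lam G H c \<longleftrightarrow>
     (\<forall>v \<in> verts G. 1 \<le> c v) \<and>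
     (\<forall>u v. {u, v} \<in> edges G \<longrightarrow> c u \<noteq> c v) \<and>
     (\<forall>u v. {u, v} \<in> edges H \<longrightarrow> int lam \<le> \<bar>int (c u) - int (c v)\<bar>)"

definition backbone_k_coloring ::
  "nat \<Rightarrow> nat \<Rightarrow> 'a graph \<Rightarrow> 'a graph \<Rightarrow> ('a \<Rightarrow> nat) \<Rightarrow> bool" where
  "backbone_k_coloring lam k G H c \<longleftrightarrow>
     backbone_coloring lam G H c \<and> (\<forall>v \<in> verts G. c v \<in> {1..k})"

definition BBC :: "nat \<Rightarrow> 'a graph \<Rightarrow> 'a graph \<Rightarrow> nat" where
  "BBC lam G H = (LEAST k. \<exists>c. backbone_k_coloring lam k G H c)"

(* The LEAST in BBC is taken over a nonempty set. *)
lemma ex_backbone_k_coloring: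
  assumes G: "is_graph G" and H: "spanning_subgraph H G"
  shows "\<exists>k c. backbone_k_coloring lam k G H c"
proof -
  obtain f :: "'a \<Rightarrow> nat" where f: "inj_on f (verts G)"
    using G finite_imp_inj_to_nat_seg unfolding is_graph_def by blast
  define c where "c v = Suc (Suc lam * f v)" for v
  have edge: "u \<in> verts G \<and> v \<in> verts G \<and> u \<noteq> v" if "{u, v} \<in> edges G" for u v
  proof -
    from that G obtain x y where "{u, v} = {x, y}" "x \<in> verts G" "y \<in> verts G" "x \<noteq> y"
      unfolding is_graph_def by blast
    then show ?thesis by (auto simp: doubleton_eq_iff)
  qed
  have dist: "int lam < \<bar>int (c u) - int (c v)\<bar>" if "{u, v} \<in> edges G" for u v
  proof -
    have "f u \<noteq> f v"
      using edge[OF that] f by (auto dest: inj_onD)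
    then have "1 \<le> \<bar>int (f u) - int (f v)\<bar>"
      by linarith
    then have "int (Suc lam) * 1 \<le> int (Suc lam) * \<bar>int (f u) - int (f v)\<bar>"
      by (intro mult_left_mono) auto
    also have "\<dots> = \<bar>int (Suc lam) * (int (f u) - int (f v))\<bar>"
      by (simp only: abs_mult abs_of_nat)
    also have "int (Suc lam) * (int (f u) - int (f v)) = int (c u) - int (c v)"
      by (simp add: c_def algebra_simps)
    finally show ?thesis by simp
  qed
  define k where "k = Max (insert 0 (c ` verts G))"
  have "c v \<le> k" if "v \<in> verts G" for v
    using that G unfolding k_def is_graph_def by (intro Max_ge) auto
  moreover have "1 \<le> c v" for v
    by (simp add: c_def)
  moreover have "c u \<noteq> c v" if "{u, v} \<in> edges G" for u v
    using dist[OF that] by auto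
  moreover have "int lam \<le> \<bar>int (c u) - int (c v)\<bar>" if "{u, v} \<in> edges H" for u v
    using dist[of u v] that H unfolding spanning_subgraph_def by auto
  ultimately have "backbone_k_coloring lam k G H c"
    unfolding backbone_k_coloring_def backbone_coloring_def by auto
  then show ?thesis by blast
qed


section \<open>Machine model and running time\<close>

text \<open>
  Time is measured on a random access machine, programmed in a structured language over
  registers and arrays of natural numbers, with unit cost per elementary operation. The only
  arithmetic is successor and (truncated) predecessor, as on a successor RAM, so unit cost cannot
  be exploited by building huge numbers: starting from values at most b, no value exceeds
  b plus the constants of the program plus the running time. The initial contents of memory not
  holding the input are arbitrary.
\<close>

type_synonym name = string

record state =
  reg :: "name \<Rightarrow> nat"
  arr :: "name \<Rightarrow> nat \<Rightarrow> nat"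

datatype aexp = Const nat | Reg name | Read name aexp | Succ aexp | Pred aexp

datatype bexp = Less aexp aexp | Equal aexp aexp | Not bexp | And bexp bexp

datatype com =
    Skip
  | Assign name aexp
  | Write name aexp aexp
  | Seq com com
  | If bexp com com
  | While bexp com

fun aval :: "aexp \<Rightarrow> state \<Rightarrow> nat" where
  "aval (Const k) s = k"
| "aval (Reg x) s = reg s x"
| "aval (Read a e) s = arr s a (aval e s)"
| "aval (Succ e) s = aval e s + 1"
| "aval (Pred e) s = aval e s - 1"

fun acost :: "aexp \<Rightarrow> nat" where
  "acost (Const k) = 1"
| "acost (Reg x) = 1"
| "acost (Read a e) = acost e + 1"
| "acost (Succ e) = acost e + 1"
| "acost (Pred e) = acost e + 1"

fun bval :: "bexp \<Rightarrow> state \<Rightarrow> bool" where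
  "bval (Less e f) s \<longleftrightarrow> aval e s < aval f s"
| "bval (Equal e f) s \<longleftrightarrow> aval e s = aval f s"
| "bval (Not b) s \<longleftrightarrow> \<not> bval b s"
| "bval (And b d) s \<longleftrightarrow> bval b s \<and> bval d s"

fun bcost :: "bexp \<Rightarrow> nat" where
  "bcost (Less e f) = acost e + acost f + 1"
| "bcost (Equal e f) = acost e + acost f + 1"
| "bcost (Not b) = bcost b + 1"
| "bcost (And b d) = bcost b + bcost d + 1"

definition set_reg :: "name \<Rightarrow> nat \<Rightarrow> state \<Rightarrow> state" where
  "set_reg x k s = s\<lparr>reg := (reg s)(x := k)\<rparr>"

definition set_arr :: "name \<Rightarrow> nat \<Rightarrow> nat \<Rightarrow> state \<Rightarrow> state" where
  "set_arr a i k s = s\<lparr>arr := (arr s)(a := (arr s a)(i := k))\<rparr>"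

text \<open>\<open>exec p s t s'\<close>: started in \<open>s\<close>, the program \<open>p\<close> halts in \<open>s'\<close> after time \<open>t\<close>.\<close>

inductive exec :: "com \<Rightarrow> state \<Rightarrow> nat \<Rightarrow> state \<Rightarrow> bool" where
  Skip: "exec Skip s 1 s"
| Assign: "exec (Assign x e) s (acost e + 1) (set_reg x (aval e s) s)"
| Write: "exec (Write a e f) s (acost e + acost f + 1) (set_arr a (aval e s) (aval f s) s)"
| Seq: "exec p s t s' \<Longrightarrow> exec q s' t' s'' \<Longrightarrow> exec (Seq p q) s (t + t') s''"
| IfTrue: "bval b s \<Longrightarrow> exec p s t s' \<Longrightarrow> exec (If b p q) s (bcost b + 1 + t) s'"
| IfFalse: "\<not> bval b s \<Longrightarrow> exec q s t s' \<Longrightarrow> exec (If b p q) s (bcost b + 1 + t) s'"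
| WhileFalse: "\<not> bval b s \<Longrightarrow> exec (While b p) s (bcost b + 1) s"
| WhileTrue: "bval b s \<Longrightarrow> exec p s t s' \<Longrightarrow> exec (While b p) s' t' s'' \<Longrightarrow>
    exec (While b p) s (bcost b + 1 + t + t') s''"

inductive_cases exec_SkipE: "exec Skip s t s'"
  and exec_AssignE: "exec (Assign x e) s t s'"
  and exec_WriteE: "exec (Write a e f) s t s'"
  and exec_SeqE: "exec (Seq p q) s t s'"
  and exec_IfE: "exec (If b p q) s t s'"
  and exec_WhileE: "exec (While b p) s t s'"

lemma exec_deterministic:
  "exec p s t s' \<Longrightarrow> exec p s u r \<Longrightarrow> u = t \<and> r = s'"
proof (induction arbitrary: u r rule: exec.induct)
  case Skip then show ?case by (auto elim: exec_SkipE)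
next
  case Assign then show ?case by (auto elim: exec_AssignE)
next
  case Write then show ?case by (auto elim: exec_WriteE)
next
  case (Seq p s t s' q t' s'')
  from Seq.prems obtain t1 r1 t2 where *: "exec p s t1 r1" "exec q r1 t2 r" "u = t1 + t2"
    by (rule exec_SeqE)
  from Seq.IH(1)[OF *(1)] have eq: "t1 = t" "r1 = s'" by blast+
  from Seq.IH(2)[OF *(2)[unfolded eq]] show ?case by (simp only: *(3) eq)
next
  case (IfTrue b s p t s' q)
  from IfTrue.prems IfTrue.hyps(1) obtain t1 where *: "exec p s t1 r" "u = bcost b + 1 + t1"
    by (auto elim!: exec_IfE)
  from IfTrue.IH[OF *(1)] show ?case by (simp only: *(2))
next
  case (IfFalse b s q t s' p)
  from IfFalse.prems IfFalse.hyps(1) obtain t1 where *: "exec q s t1 r" "u = bcost b + 1 + t1"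
    by (auto elim!: exec_IfE)
  from IfFalse.IH[OF *(1)] show ?case by (simp only: *(2))
next
  case (WhileFalse b s p)
  from WhileFalse.prems WhileFalse.hyps show ?case
    by (auto elim!: exec_WhileE)
next
  case (WhileTrue b s p t s' t' s'')
  from WhileTrue.prems obtain t1 r1 t2
    where *: "exec p s t1 r1" "exec (While b p) r1 t2 r" "u = bcost b + 1 + t1 + t2"
    by (rule exec_WhileE) (use WhileTrue.hyps(1) in auto)
  from WhileTrue.IH(1)[OF *(1)] have eq: "t1 = t" "r1 = s'" by blast+
  from WhileTrue.IH(2)[OF *(2)[unfolded eq]] show ?case by (simp only: *(3) eq)
qed


section \<open>Input and output conventions\<close>

text \<open>
  Adjacency lists stored contiguously, in arbitrary order: the vertices of \<open>G\<close> are numbered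
  by their position in \<open>vs\<close>, and the neighbours of vertex number \<open>i\<close> are
  the entries of the array \<open>adj\<close> at positions \<open>off i, \<dots>, off (i + 1) - 1\<close>.
\<close>

definition adjacency_lists :: "(nat \<Rightarrow> nat) \<Rightarrow> (nat \<Rightarrow> nat) \<Rightarrow> 'a list \<Rightarrow> 'a graph \<Rightarrow> bool" where
  "adjacency_lists off adj vs G \<longleftrightarrow>
     distinct vs \<and> set vs = verts G \<and> off 0 = 0 \<and>
     (\<forall>i < length vs. off i \<le> off (i + 1) \<and>
        bij_betw adj {off i..<off (i + 1)} {j. j < length vs \<and> {vs ! i, vs ! j} \<in> edges G})"

definition encodes_input :: "state \<Rightarrow> 'a list \<Rightarrow> 'a graph \<Rightarrow> 'a graph \<Rightarrow> nat \<Rightarrow> bool" where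
  "encodes_input s vs G H lam \<longleftrightarrow>
     reg s ''n'' = length vs \<and> reg s ''lambda'' = lam \<and>
     adjacency_lists (arr s ''G_off'') (arr s ''G_adj'') vs G \<and>
     adjacency_lists (arr s ''H_off'') (arr s ''H_adj'') vs H"

definition encodes_coloring :: "state \<Rightarrow> 'a list \<Rightarrow> ('a \<Rightarrow> nat) \<Rightarrow> bool" where
  "encodes_coloring s vs c \<longleftrightarrow> (\<forall>i < length vs. arr s ''color'' i = c (vs ! i))"

end

theory Submission imports Defs
begin

text \<open>
  Use the low colors \<open>1, 2, 3\<close> and the high colors \<open>\<lambda> + 1, \<lambda> + 2, \<lambda> + 3\<close>; the low color \<open>i\<close> and the
  high color \<open>\<lambda> + k\<close> may meet on a matching edge if and only if \<open>i \<le> k\<close>. Contract the matching edges,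
  so that a node is a matching edge or an unmatched vertex. A node that still has an uncolored
  neighbor sees at most five colored vertices, and one of the two ways to send its ends to the low
  and the high colors meets at most two of them in their own half; this always leaves a choice.
  Hence, coloring the nodes of a component towards the root of a spanning tree, only the root can
  be obstructed, and only if both of its ends have degree 4 and see the same three colors:
  \<open>{1, 2, 3}\<close>, \<open>{1, 2, \<lambda> + 3}\<close> or one of the mirror images of these two under
  \<open>c \<mapsto> \<lambda> + 4 - c\<close>. None of these sets contains the color 3 together with a high color.

  If every node of the component is such a node, take the last node \<open>A\<close> of a breadth-first search.
  All neighbors of \<open>A\<close> but its parent \<open>P\<close> are leaves of the search tree. If an end of \<open>A\<close> has two
  neighbors outside \<open>A\<close> and \<open>P\<close>, give them the color 3 and a high color beforehand and take \<open>A\<close> as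
  root. Otherwise both ends of \<open>P\<close> are adjacent to both ends of \<open>A\<close>; give \<open>A\<close> the colors \<open>3\<close> and
  \<open>\<lambda> + 3\<close> beforehand and take \<open>P\<close> as root. In either case the uncolored nodes still span a subtree.
\<close>

section \<open>Loop-free programs and loops\<close>

text \<open>The \<open>While\<close> clauses here and in \<open>mcost\<close> are dummies: both
  functions are consulted only for loop-free programs, where they give the final state and a
  worst-case time.\<close>

fun den :: "com \<Rightarrow> state \<Rightarrow> state" where
  "den Skip s = s"
| "den (Assign x e) s = set_reg x (aval e s) s"
| "den (Write a e f) s = set_arr a (aval e s) (aval f s) s"
| "den (Seq p q) s = den q (den p s)"
| "den (If b p q) s = (if bval b s then den p s else den q s)"
| "den (While b p) s = s"

fun loopfree :: "com \<Rightarrow> bool" where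
  "loopfree (Seq p q) \<longleftrightarrow> loopfree p \<and> loopfree q"
| "loopfree (If b p q) \<longleftrightarrow> loopfree p \<and> loopfree q"
| "loopfree (While b p) \<longleftrightarrow> False"
| "loopfree p \<longleftrightarrow> True"

fun mcost :: "com \<Rightarrow> nat" where
  "mcost Skip = 1"
| "mcost (Assign x e) = acost e + 1"
| "mcost (Write a e f) = acost e + acost f + 1"
| "mcost (Seq p q) = mcost p + mcost q"
| "mcost (If b p q) = bcost b + 1 + max (mcost p) (mcost q)"
| "mcost (While b p) = 0"

lemma exec_den: "loopfree p \<Longrightarrow> \<exists>t\<le>mcost p. exec p s t (den p s)"
proof (induction p arbitrary: s)
  case (Seq p q)
  then obtain t t' where "t \<le> mcost p" "exec p s t (den p s)"
    "t' \<le> mcost q" "exec q (den p s) t' (den q (den p s))" by (meson loopfree.simps(1))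
  then show ?case by (intro exI[of _ "t + t'"]) (auto intro: exec.Seq)
next
  case (If b p q)
  show ?case
  proof (cases "bval b s")
    case True
    with If obtain t where "t \<le> mcost p" "exec p s t (den p s)" by (meson loopfree.simps(2))
    with True show ?thesis by (intro exI[of _ "bcost b + 1 + t"]) (auto intro: exec.IfTrue[simplified])
  next
    case False
    with If obtain t where "t \<le> mcost q" "exec q s t (den q s)" by (meson loopfree.simps(2))
    with False show ?thesis by (intro exI[of _ "bcost b + 1 + t"]) (auto intro: exec.IfFalse[simplified])
  qed
qed (auto intro: exec.Skip[simplified] exec.Assign[simplified] exec.Write[simplified])

fun wregs :: "com \<Rightarrow> name set" where
  "wregs (Assign x e) = {x}"
| "wregs (Seq p q) = wregs p \<union> wregs q"
| "wregs (If b p q) = wregs p \<union> wregs q"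
| "wregs (While b p) = wregs p"
| "wregs p = {}"

fun warrs :: "com \<Rightarrow> name set" where
  "warrs (Write a e f) = {a}"
| "warrs (Seq p q) = warrs p \<union> warrs q"
| "warrs (If b p q) = warrs p \<union> warrs q"
| "warrs (While b p) = warrs p"
| "warrs p = {}"

text \<open>Syntactic bookkeeping: a loop invariant only has to mention what the loop changes;
  everything else is carried over by inspecting the written names.\<close>

definition frame :: "com \<Rightarrow> state \<Rightarrow> state \<Rightarrow> bool" where
  "frame p s s' \<longleftrightarrow> (\<forall>x. x \<notin> wregs p \<longrightarrow> reg s' x = reg s x) \<and> (\<forall>a. a \<notin> warrs p \<longrightarrow> arr s' a = arr s a)"

lemma frame_refl [simp]: "frame p s s"
  by (simp add: frame_def)

lemma frame_trans: "frame p s s' \<Longrightarrow> frame p s' s'' \<Longrightarrow> frame p s s''"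
  by (simp add: frame_def)

lemma frame_den: "frame p s (den p s)"
  by (induction p arbitrary: s) (auto simp: frame_def set_reg_def set_arr_def)

lemma frame_reg: "frame p s s' \<Longrightarrow> x \<notin> wregs p \<Longrightarrow> reg s' x = reg s x"
  by (simp add: frame_def)

lemma frame_arr: "frame p s s' \<Longrightarrow> a \<notin> warrs p \<Longrightarrow> arr s' a = arr s a"
  by (simp add: frame_def)

text \<open>Amortized analysis: every iteration pays for its body and its test out of the drop of
  the potential. The drop is at least 1, so the induction is well-founded. The extra
  \<open>bcost b + 1\<close> is the last, failing test. The body may contain loops, as that of the
  outermost loop does.\<close>

lemma exec_While_potential:
  fixes \<Phi> :: "state \<Rightarrow> nat"
  assumes step: "\<And>s. I s \<Longrightarrow> bval b s \<Longrightarrow>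
    \<exists>t s'. exec p s t s' \<and> I s' \<and> t + bcost b + 1 + \<Phi> s' \<le> \<Phi> s"
  shows "I s \<Longrightarrow> \<exists>t s'. exec (While b p) s t s' \<and> I s' \<and> \<not> bval b s' \<and> t + \<Phi> s' \<le> \<Phi> s + bcost b + 1"
proof (induction "\<Phi> s" arbitrary: s rule: less_induct)
  case less
  show ?case
  proof (cases "bval b s")
    case False
    then show ?thesis using less.prems
      by (intro exI[of _ "bcost b + 1"] exI[of _ s]) (auto intro: exec.WhileFalse[simplified])
  next
    case True
    from step[OF less.prems True] obtain t s' where
      t: "exec p s t s'" "I s'" "t + bcost b + 1 + \<Phi> s' \<le> \<Phi> s" by blast
    from less.hyps[of s'] t obtain t' s'' where
      t': "exec (While b p) s' t' s''" "I s''" "\<not> bval b s''" "t' + \<Phi> s'' \<le> \<Phi> s' + bcost b + 1"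
      by (auto simp: less_eq_Suc_le)
    show ?thesis using exec.WhileTrue[OF True t(1) t'(1)] t t'
      by (intro exI[of _ "bcost b + 1 + t + t'"] exI[of _ s'']) auto
  qed
qed

definition iter_cost :: "bexp \<Rightarrow> com \<Rightarrow> nat" where
  "iter_cost b p = mcost p + bcost b + 1"

text \<open>A loop-free body has a constant time bound, so this constant times a decreasing measure
  is a potential. The measure left at exit is kept on the left-hand side, so that the measure may
  start from a coarse value such as \<open>n\<close>.\<close>

lemma exec_While_measure:
  fixes \<mu> :: "state \<Rightarrow> nat"
  assumes lf: "loopfree p" and "I s"
    and step: "\<And>s'. frame p s s' \<Longrightarrow> I s' \<Longrightarrow> bval b s' \<Longrightarrow> I (den p s') \<and> \<mu> (den p s') < \<mu> s'"
  shows "\<exists>t s'. exec (While b p) s t s' \<and> frame p s s' \<and> I s' \<and> \<not> bval b s' \<and>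
    t + iter_cost b p * \<mu> s' \<le> iter_cost b p * (\<mu> s + 1)"
proof -
  let ?K = "iter_cost b p" and ?I = "\<lambda>s'. frame p s s' \<and> I s'"
  have "\<exists>t s''. exec p s' t s'' \<and> ?I s'' \<and> t + bcost b + 1 + ?K * \<mu> s'' \<le> ?K * \<mu> s'"
    if "?I s'" "bval b s'" for s'
  proof -
    obtain t where t: "t \<le> mcost p" "exec p s' t (den p s')" using exec_den[OF lf] by blast
    have st: "I (den p s')" "\<mu> (den p s') < \<mu> s'" using step[of s'] that by auto
    then have "?K * (\<mu> (den p s') + 1) \<le> ?K * \<mu> s'" by (intro mult_left_mono) auto
    moreover have "frame p s (den p s')" using frame_trans[OF _ frame_den] that by blast
    ultimately show ?thesis using t st
      by (intro exI[of _ t] exI[of _ "den p s'"]) (auto simp: iter_cost_def)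
  qed
  from exec_While_potential[of ?I b p "\<lambda>s. ?K * \<mu> s", OF this, of s] \<open>I s\<close> show ?thesis
    by (fastforce simp: iter_cost_def)
qed

section \<open>State updates and combinators for straight-line code\<close>

lemma state_simps [simp]:
  "reg (set_reg x k s) = (reg s)(x := k)"
  "arr (set_reg x k s) = arr s"
  "reg (set_arr a i k s) = reg s"
  "arr (set_arr a i k s) = (arr s)(a := (arr s a)(i := k))"
  by (simp_all add: set_reg_def set_arr_def)

fun seqs :: "com list \<Rightarrow> com" where
  "seqs [] = Skip"
| "seqs (p # ps) = Seq p (seqs ps)"

lemma loopfree_seqs [simp]: "loopfree (seqs ps) \<longleftrightarrow> (\<forall>p\<in>set ps. loopfree p)"
  by (induction ps) auto

lemma wregs_seqs [simp]: "wregs (seqs ps) = (\<Union>p\<in>set ps. wregs p)"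
  by (induction ps) auto

lemma warrs_seqs [simp]: "warrs (seqs ps) = (\<Union>p\<in>set ps. warrs p)"
  by (induction ps) auto

lemma den_seqs_append: "den (seqs (ps @ qs)) s = den (seqs qs) (den (seqs ps) s)"
  by (induction ps arbitrary: s) auto

text \<open>Invariant rule for an unrolled loop; the index will run over the at most four entries of
  an adjacency list.\<close>

lemma den_seqs_upt:
  assumes "I 0 s" "\<And>d s. d < m \<Longrightarrow> I d s \<Longrightarrow> I (Suc d) (den (f d) s)"
  shows "I m (den (seqs (map f [0..<m])) s)"
  using assms by (induction m) (auto simp: den_seqs_append)

fun chain :: "(bexp \<times> com) list \<Rightarrow> com \<Rightarrow> com" where
  "chain [] q = q"
| "chain ((b, p) # xs) q = If b p (chain xs q)"

lemma loopfree_chain [simp]: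
  "loopfree (chain xs q) \<longleftrightarrow> loopfree q \<and> (\<forall>(b, p)\<in>set xs. loopfree p)"
  by (induction xs q rule: chain.induct) auto

lemma wregs_chain [simp]: "wregs (chain xs q) = wregs q \<union> (\<Union>(b, p)\<in>set xs. wregs p)"
  by (induction xs q rule: chain.induct) auto

lemma warrs_chain [simp]: "warrs (chain xs q) = warrs q \<union> (\<Union>(b, p)\<in>set xs. warrs p)"
  by (induction xs q rule: chain.induct) auto

text \<open>The order of the tests is forgotten on purpose: in every use, any branch whose guard
  holds is correct.\<close>

lemma den_chain:
  "(\<exists>(b, p)\<in>set xs. bval b s \<and> den (chain xs q) s = den p s) \<or>
   (\<forall>(b, p)\<in>set xs. \<not> bval b s) \<and> den (chain xs q) s = den q s"
  by (induction xs q rule: chain.induct) auto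

definition all_of :: "bexp list \<Rightarrow> bexp" where
  "all_of bs = foldr And bs (Equal (Const 0) (Const 0))"

lemma bval_all_of [simp]: "bval (all_of bs) s \<longleftrightarrow> (\<forall>b\<in>set bs. bval b s)"
  unfolding all_of_def by (induction bs) auto

fun add_const :: "aexp \<Rightarrow> nat \<Rightarrow> aexp" where
  "add_const e 0 = e"
| "add_const e (Suc d) = Succ (add_const e d)"

lemma aval_plus [simp]: "aval (add_const e d) s = aval e s + d"
  by (induction d) auto

section \<open>Partial backbone colorings\<close>

text \<open>The input with vertices renamed to positions. The matching becomes an involution
  \<open>mate\<close> whose fixed points are the unmatched vertices.\<close>

locale backbone_graph =
  fixes n :: nat and N :: "nat \<Rightarrow> nat set" and mate :: "nat \<Rightarrow> nat" and lam :: nat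
  assumes N_less: "x < n \<Longrightarrow> y \<in> N x \<Longrightarrow> y < n"
    and N_sym: "x < n \<Longrightarrow> y \<in> N x \<Longrightarrow> x \<in> N y"
    and N_irrefl: "x < n \<Longrightarrow> x \<notin> N x"
    and card_N: "x < n \<Longrightarrow> card (N x) \<le> 4"
    and mate_N: "x < n \<Longrightarrow> mate x \<noteq> x \<Longrightarrow> mate x \<in> N x"
    and mate_mate [simp]: "x < n \<Longrightarrow> mate (mate x) = x"
    and lam: "3 \<le> lam"
begin

lemma mate_less: "x < n \<Longrightarrow> mate x < n"
  using N_less mate_N by (cases "mate x = x") auto

lemma finite_N: "x < n \<Longrightarrow> finite (N x)"
  by (rule finite_subset[of _ "{..<n}"]) (auto dest: N_less)

definition node :: "nat \<Rightarrow> nat set" where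
  "node x = {x, mate x}"

lemma node_less: "x < n \<Longrightarrow> y \<in> node x \<Longrightarrow> y < n"
  by (auto simp: node_def mate_less)

lemma node_sym: "x < n \<Longrightarrow> y \<in> node x \<Longrightarrow> x \<in> node y"
  by (auto simp: node_def)

lemma node_eq: "x < n \<Longrightarrow> y \<in> node x \<Longrightarrow> node y = node x"
  by (auto simp: node_def)

definition palette :: "nat set" where
  "palette = {1, 2, 3, lam + 1, lam + 2, lam + 3}"

definition far :: "nat \<Rightarrow> nat \<Rightarrow> bool" where
  "far c d \<longleftrightarrow> lam + c \<le> d \<or> lam + d \<le> c"

text \<open>The color 0 stands for uncolored.\<close>

definition partial :: "(nat \<Rightarrow> nat) \<Rightarrow> bool" where
  "partial col \<longleftrightarrow> (\<forall>x<n. (col x \<noteq> 0 \<longrightarrow> col x \<in> palette) \<and> (col (mate x) = 0 \<longleftrightarrow> col x = 0) \<and>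
     (col x \<noteq> 0 \<longrightarrow> (\<forall>y\<in>N x. col y \<noteq> col x) \<and> (mate x \<noteq> x \<longrightarrow> far (col x) (col (mate x)))))"

text \<open>Colors a whole node. Both ends were uncolored, so the tests in the old coloring ignore
  the mate, whose new color differs because far colors are at least \<open>lam > 0\<close> apart.
  For an unmatched vertex both updates hit the same place, hence \<open>c = d\<close>.\<close>

lemma partial_update:
  assumes "partial col" "u < n" "col u = 0" "c \<in> palette" "d \<in> palette"
    and "mate u = u \<Longrightarrow> c = d" and "mate u \<noteq> u \<Longrightarrow> far c d"
    and "\<And>y. y \<in> N u \<Longrightarrow> col y \<noteq> c" and "\<And>y. y \<in> N (mate u) \<Longrightarrow> col y \<noteq> d"
  shows "partial (col(u := c, mate u := d))"
  unfolding partial_def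
proof (intro allI impI)
  fix x assume x: "x < n"
  let ?c = "col(u := c, mate u := d)"
  have pos: "c \<noteq> 0" "d \<noteq> 0" using assms(4,5) by (auto simp: palette_def)
  have cd: "c \<noteq> d" if "mate u \<noteq> u" using assms(7)[OF that] lam by (auto simp: far_def)
  have x_node: "mate x \<in> node u \<longleftrightarrow> x \<in> node u"
    using mate_mate[OF x] mate_mate[OF assms(2)] unfolding node_def insert_iff empty_iff by metis
  have old: "(col x \<noteq> 0 \<longrightarrow> col x \<in> palette)" "(col (mate x) = 0 \<longleftrightarrow> col x = 0)"
     "(col x \<noteq> 0 \<longrightarrow> (\<forall>y\<in>N x. col y \<noteq> col x) \<and> (mate x \<noteq> x \<longrightarrow> far (col x) (col (mate x))))"
    using assms(1) x by (auto simp: partial_def)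
  consider "x = u" | "x = mate u" "mate u \<noteq> u" | "x \<notin> node u" by (auto simp: node_def)
  then show "(?c x \<noteq> 0 \<longrightarrow> ?c x \<in> palette) \<and> (?c (mate x) = 0 \<longleftrightarrow> ?c x = 0) \<and>
     (?c x \<noteq> 0 \<longrightarrow> (\<forall>y\<in>N x. ?c y \<noteq> ?c x) \<and> (mate x \<noteq> x \<longrightarrow> far (?c x) (?c (mate x))))"
  proof cases
    case 1
    then show ?thesis using assms pos cd N_irrefl[of u] by auto
  next
    case 2
    then show ?thesis using assms pos cd N_irrefl[of "mate u"] mate_less[of u]
      by (auto simp: far_def)
  next
    case 3
    then have nn: "mate x \<notin> node u" using x_node by simp
    have "?c y \<noteq> col x" if "y \<in> N x" "col x \<noteq> 0" for y
      using that old assms(8,9) N_sym[OF x] by (metis fun_upd_apply)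
    then show ?thesis using 3 nn old by (auto simp: node_def)
  qed
qed

section \<open>Choosing the colors of one node\<close>

lemma card_palette_subset:
  assumes "A \<subseteq> palette"
  shows "card A = (\<Sum>c\<in>palette. of_bool (c \<in> A))"
proof -
  have "(\<Sum>c\<in>palette. of_bool (c \<in> A)) = card (palette \<inter> A)"
    by (subst sum_of_bool_eq) (auto simp: palette_def Int_def)
  then show ?thesis using assms by (simp add: Int_absorb1)
qed

text \<open>\<open>a1, ..., a6\<close> and \<open>b1, ..., b6\<close> say which palette colors, in
  increasing order, the two ends see; the twelve disjunctions block all far pairs. The first six
  involve only \<open>a1, a2, a3, b4, b5, b6\<close> and contain three disjoint ones, so at least
  three of these hold; likewise for the other six. Hence at least six hold in all. With exactly six,
  each of the disjoint clauses has one true member, so \<open>a3\<close> excludes \<open>b6\<close>,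
  which forces \<open>a1\<close> and \<open>a2\<close>; then the first end sees no high color. The
  case of \<open>b3\<close> is symmetric.\<close>

lemma twelve_bools:
  fixes a1 :: bool
  assumes "a1 \<or> b4" "a1 \<or> b5" "a1 \<or> b6" "a2 \<or> b5" "a2 \<or> b6" "a3 \<or> b6"
    "a4 \<or> b1" "a5 \<or> b1" "a6 \<or> b1" "a5 \<or> b2" "a6 \<or> b2" "a6 \<or> b3"
    and "of_bool a1 + of_bool a2 + of_bool a3 + of_bool a4 + of_bool a5 + of_bool a6 +
      (of_bool b1 + of_bool b2 + of_bool b3 + of_bool b4 + of_bool b5 + of_bool b6) \<le> (5::nat) \<or>
      a3 \<and> (a4 \<or> a5 \<or> a6) \<or> b3 \<and> (b4 \<or> b5 \<or> b6)"
    and "of_bool a1 + of_bool a2 + of_bool a3 + of_bool a4 + of_bool a5 + of_bool a6 \<le> (3::nat)"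
    and "of_bool b1 + of_bool b2 + of_bool b3 + of_bool b4 + of_bool b5 + of_bool b6 \<le> (3::nat)"
  shows False
  using assms
  by (cases a1; cases a2; cases a3; cases a4; cases a5; cases a6; simp only: simp_thms of_bool_eq;
      auto simp: of_bool_def split: if_splits)

text \<open>\<open>A\<close> and \<open>B\<close> are the colors seen by the two ends of a matching
  edge. Even two full sets of three are harmless if one of them contains 3 and a high color; the
  precolorings chosen later aim at exactly this.\<close>

lemma far_choice:
  assumes A: "A \<subseteq> palette" "card A \<le> 3" and B: "B \<subseteq> palette" "card B \<le> 3"
    and or: "card A + card B \<le> 5 \<or> 3 \<in> A \<and> (\<exists>h\<in>A. 3 < h) \<or> 3 \<in> B \<and> (\<exists>h\<in>B. 3 < h)"
  shows "\<exists>c\<in>palette. \<exists>d\<in>palette. far c d \<and> c \<notin> A \<and> d \<notin> B"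
proof (rule ccontr)
  assume "\<not> ?thesis"
  then have block: "c \<in> A \<or> d \<in> B" if "c \<in> palette" "d \<in> palette" "far c d" for c d
    using that by blast
  define a where "a i = (i \<in> A)" for i
  define b where "b i = (i \<in> B)" for i
  have sum: "(\<Sum>c\<in>palette. f c) = f 1 + f 2 + f 3 + f (lam+1) + f (lam+2) + f (lam+3)" for f :: "nat \<Rightarrow> nat"
    using lam by (simp add: palette_def)
  have cA: "card A = of_bool (a 1) + of_bool (a 2) + of_bool (a 3) + of_bool (a (lam+1)) +
      of_bool (a (lam+2)) + of_bool (a (lam+3))"
    unfolding card_palette_subset[OF A(1)] sum a_def ..
  have cB: "card B = of_bool (b 1) + of_bool (b 2) + of_bool (b 3) + of_bool (b (lam+1)) +
      of_bool (b (lam+2)) + of_bool (b (lam+3))"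
    unfolding card_palette_subset[OF B(1)] sum b_def ..
  have high: "lam+1 \<in> C \<or> lam+2 \<in> C \<or> lam+3 \<in> C" if "C \<subseteq> palette" "h \<in> C" "3 < h" for C h
    using that by (auto simp: palette_def dest!: subsetD)
  have or': "card A + card B \<le> 5 \<or> a 3 \<and> (a (lam+1) \<or> a (lam+2) \<or> a (lam+3)) \<or>
      b 3 \<and> (b (lam+1) \<or> b (lam+2) \<or> b (lam+3))"
    using or high[OF A(1)] high[OF B(1)] unfolding a_def b_def by metis
  have bl: "a 1 \<or> b (lam+1)" "a 1 \<or> b (lam+2)" "a 1 \<or> b (lam+3)" "a 2 \<or> b (lam+2)" "a 2 \<or> b (lam+3)"
    "a 3 \<or> b (lam+3)" "a (lam+1) \<or> b 1" "a (lam+2) \<or> b 1" "a (lam+3) \<or> b 1" "a (lam+2) \<or> b 2"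
    "a (lam+3) \<or> b 2" "a (lam+3) \<or> b 3"
    using block unfolding a_def b_def by (auto simp: palette_def far_def)
  show False
    by (rule twelve_bools[OF bl or'[unfolded cA cB] A(2)[unfolded cA] B(2)[unfolded cB]])
qed

text \<open>These nodes can be colored whatever their neighbors have: an unmatched vertex sees at
  most four of the six colors, and an end of degree at most 3 sees at most two besides its uncolored
  mate.\<close>

definition low :: "nat \<Rightarrow> bool" where
  "low u \<longleftrightarrow> mate u = u \<or> card (N u) \<noteq> 4 \<or> card (N (mate u)) \<noteq> 4"

text \<open>\<open>3 < col z\<close> means that \<open>z\<close> has a high color. Unlike
  \<open>waiting\<close>, this property survives every extension of the coloring, so it suits the
  node colored last.\<close>

definition rootable :: "(nat \<Rightarrow> nat) \<Rightarrow> nat \<Rightarrow> bool" where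
  "rootable col u \<longleftrightarrow> low u \<or> (\<exists>x\<in>node u. \<exists>y\<in>N x. \<exists>z\<in>N x. col y = 3 \<and> 3 < col z)"

definition waiting :: "(nat \<Rightarrow> nat) \<Rightarrow> nat \<Rightarrow> bool" where
  "waiting col u \<longleftrightarrow> (\<exists>x\<in>node u. \<exists>y\<in>N x. y \<notin> node u \<and> col y = 0)"

lemma single_choice:
  assumes col: "partial col" and u: "u < n"
  shows "\<exists>c\<in>palette. \<forall>y\<in>N u. col y \<noteq> c"
proof (rule ccontr)
  assume "\<not> ?thesis"
  then have "palette \<subseteq> col ` N u" by auto
  then have "card palette \<le> card (col ` N u)" using finite_N[OF u] by (intro card_mono) auto
  also have "\<dots> \<le> 4" using card_image_le[OF finite_N[OF u], of col] card_N[OF u] by linarith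
  finally show False using lam by (simp add: palette_def)
qed

text \<open>The mate is uncolored, so each end sees at most three colors. In a \<open>low\<close> or
  \<open>waiting\<close> node one end sees at most two, by a smaller degree or a further uncolored
  neighbor, and the sum drops to five.\<close>

lemma pair_choice:
  assumes col: "partial col" and u: "u < n" "mate u \<noteq> u" "col u = 0"
    and ok: "rootable col u \<or> waiting col u"
  shows "\<exists>c\<in>palette. \<exists>d\<in>palette. far c d \<and> (\<forall>y\<in>N u. col y \<noteq> c) \<and> (\<forall>y\<in>N (mate u). col y \<noteq> d)"
proof -
  define v where "v = mate u"
  have v: "v < n" "mate v = u" "col v = 0" "v \<noteq> u" "v \<in> N u" "u \<in> N v"
    using u mate_less col mate_N[of u] N_sym[of u v] by (auto simp: v_def partial_def)
  define S where "S x = {y\<in>N x. col y \<noteq> 0}" for x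
  define A where "A x = col ` S x" for x
  \<comment> \<open>\<open>z\<close> is an optional further uncolored neighbor; the indicator gives
    the bounds with and without it in one statement.\<close>
  have S3: "card (S x) \<le> card (N x) - 1 - of_bool (z \<in> N x - {mate x} \<and> col z = 0) \<and> finite (S x)"
    if "x \<in> {u, v}" for x z
  proof -
    let ?Z = "insert (mate x) (if z \<in> N x - {mate x} \<and> col z = 0 then {z} else {})"
    have x: "x < n" "mate x \<in> N x" "col (mate x) = 0" using that u v by (auto simp: v_def)
    have "S x \<subseteq> N x - ?Z" using x by (auto simp: S_def)
    then have "card (S x) \<le> card (N x - ?Z)" using finite_N[OF x(1)] by (intro card_mono) auto
    also have "\<dots> = card (N x) - card ?Z" using x finite_N[OF x(1)] by (subst card_Diff_subset) auto
    also have "card ?Z = 1 + of_bool (z \<in> N x - {mate x} \<and> col z = 0)" by auto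
    finally show ?thesis using finite_N[OF x(1)] by (auto simp: S_def)
  qed
  have cA: "card (A x) \<le> card (S x)" if "x \<in> {u, v}" for x
    using card_image_le[of "S x" col] S3[OF that] by (auto simp: A_def)
  have le3: "card (A x) \<le> 3" if "x \<in> {u, v}" for x
    using that S3[of x] cA[of x] card_N[of x] u v by fastforce
  have sub: "A x \<subseteq> palette" if "x \<in> {u, v}" for x
  proof
    fix c assume "c \<in> A x"
    then obtain y where "y \<in> N x" "col y \<noteq> 0" "c = col y" by (auto simp: A_def S_def)
    moreover have "y < n" using \<open>y \<in> N x\<close> N_less that u v by blast
    ultimately show "c \<in> palette" using col by (simp add: partial_def)
  qed
  have "card (A u) + card (A v) \<le> 5 \<or> 3 \<in> A u \<and> (\<exists>h\<in>A u. 3 < h) \<or> 3 \<in> A v \<and> (\<exists>h\<in>A v. 3 < h)"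
  proof (cases "low u \<or> waiting col u")
    case False
    with ok obtain x y z where "x \<in> {u, v}" "y \<in> N x" "z \<in> N x" "col y = 3" "3 < col z"
      by (auto simp: rootable_def node_def v_def)
    then have "3 \<in> A x \<and> (\<exists>h\<in>A x. 3 < h)" unfolding A_def S_def by force
    with \<open>x \<in> {u, v}\<close> show ?thesis by auto
  next
    case True
    have le: "card (A x) \<le> card (N x) - 1" "card (N x) \<le> 4" if "x \<in> {u, v}" for x
      using cA[OF that] S3[OF that, of 0] card_N[of x] that u v by auto
    have less: "card (A x) \<le> 2" if "x \<in> {u, v}" "z \<in> N x" "z \<notin> {u, v}" "col z = 0" for x z
      using cA[OF that(1)] S3[OF that(1), of z] card_N[of x] that u v by (auto simp: v_def)
    have "card (N u) \<noteq> 4 \<or> card (N v) \<noteq> 4 \<or> card (A u) \<le> 2 \<or> card (A v) \<le> 2"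
      using True u less by (auto simp: low_def waiting_def node_def v_def)
    then show ?thesis using le[of u] le[of v] by auto
  qed
  from far_choice[OF sub le3 sub le3 this] obtain c d where
    cd: "c \<in> palette" "d \<in> palette" "far c d" "c \<notin> A u" "d \<notin> A v" by auto
  moreover have "c \<noteq> 0" "d \<noteq> 0" using cd by (auto simp: palette_def)
  ultimately show ?thesis unfolding A_def S_def v_def by (intro bexI[of _ c] bexI[of _ d]) auto
qed


section \<open>Breadth-first search on the contracted graph\<close>

text \<open>The queue \<open>Q\<close>, filled up to \<open>t\<close>, holds one vertex of every node found, also in earlier
  components; the search of the current component started at position \<open>st\<close> and scans position
  \<open>h\<close> next, and \<open>par j\<close> is the position in \<open>Q\<close> of the parent of \<open>Q j\<close>.\<close>

definition bfs ::
  "(nat \<Rightarrow> nat) \<Rightarrow> (nat \<Rightarrow> nat) \<Rightarrow> (nat \<Rightarrow> nat) \<Rightarrow> nat \<Rightarrow> nat \<Rightarrow> nat \<Rightarrow> bool" where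
  "bfs Q vis par st h t \<longleftrightarrow>
     st \<le> h \<and> h \<le> t \<and> st < t \<and> par st = st \<and>
     (\<forall>j<t. Q j < n) \<and> (\<forall>i<t. \<forall>j<t. Q i \<in> node (Q j) \<longrightarrow> i = j) \<and>
     (\<forall>x<n. vis x \<noteq> 0 \<longleftrightarrow> (\<exists>j<t. x \<in> node (Q j))) \<and>
     (\<forall>j<h. \<forall>x\<in>node (Q j). \<forall>y\<in>N x. vis y \<noteq> 0) \<and>
     (\<forall>j. st < j \<and> j < t \<longrightarrow> st \<le> par j \<and> par j < j \<and> (\<exists>x\<in>node (Q (par j)). Q j \<in> N x)) \<and>
     (\<forall>j. st \<le> j \<and> j < t \<longrightarrow> par j \<le> h) \<and>
     (\<forall>i j. st \<le> i \<and> i \<le> j \<and> j < t \<longrightarrow> par i \<le> par j) \<and>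
     (\<forall>j. st \<le> j \<and> j < t \<longrightarrow> (\<forall>i<par j. \<forall>x\<in>node (Q i). N x \<inter> node (Q j) = {}))"

text \<open>What remains of \<open>bfs\<close> once a component is finished: no edge leaves the set
  of visited nodes.\<close>

definition searched :: "(nat \<Rightarrow> nat) \<Rightarrow> (nat \<Rightarrow> nat) \<Rightarrow> nat \<Rightarrow> bool" where
  "searched Q vis t \<longleftrightarrow> (\<forall>j<t. Q j < n) \<and> (\<forall>i<t. \<forall>j<t. Q i \<in> node (Q j) \<longrightarrow> i = j) \<and>
     (\<forall>x<n. vis x \<noteq> 0 \<longleftrightarrow> (\<exists>j<t. x \<in> node (Q j))) \<and>
     (\<forall>j<t. \<forall>x\<in>node (Q j). \<forall>y\<in>N x. vis y \<noteq> 0)"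

lemma bfs_searched: "bfs Q vis par st t t \<Longrightarrow> searched Q vis t"
  by (simp add: bfs_def searched_def)

text \<open>A vertex lies in its own node, so \<open>Q\<close> is injective on the filled part. The
  bound allows \<open>n - tail\<close> to serve as a potential.\<close>

lemma queue_length:
  assumes "\<forall>j<t. Q j < n" "\<forall>i<t. \<forall>j<t. Q i \<in> node (Q j) \<longrightarrow> i = j"
  shows "t \<le> n"
proof -
  have "inj_on Q {..<t}" using assms by (auto simp: inj_on_def node_def)
  then have "card {..<t} \<le> card {..<n}" using assms(1) by (intro card_inj_on_le[of Q]) auto
  then show ?thesis by simp
qed

lemma bfsD:
  assumes "bfs Q vis par st h t"
  shows bfs_bounds: "st < t" "st \<le> h" "h \<le> t"
    and bfs_less: "\<And>j. j < t \<Longrightarrow> Q j < n"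
    and bfs_inj: "\<And>i j. i < t \<Longrightarrow> j < t \<Longrightarrow> Q i \<in> node (Q j) \<Longrightarrow> i = j"
    and bfs_vis: "\<And>x. x < n \<Longrightarrow> vis x \<noteq> 0 \<longleftrightarrow> (\<exists>j<t. x \<in> node (Q j))"
    and bfs_closed: "\<And>j x y. j < h \<Longrightarrow> x \<in> node (Q j) \<Longrightarrow> y \<in> N x \<Longrightarrow> vis y \<noteq> 0"
    and bfs_par_less: "\<And>j. st < j \<Longrightarrow> j < t \<Longrightarrow> par j < j"
    and bfs_par_edge: "\<And>j. st < j \<Longrightarrow> j < t \<Longrightarrow> \<exists>x\<in>node (Q (par j)). Q j \<in> N x"
    and bfs_par_start: "par st = st"
    and bfs_par_mono: "\<And>i j. st \<le> i \<Longrightarrow> i \<le> j \<Longrightarrow> j < t \<Longrightarrow> par i \<le> par j"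
    and bfs_separate: "\<And>i j x y. st \<le> j \<Longrightarrow> j < t \<Longrightarrow> i < par j \<Longrightarrow> x \<in> node (Q i) \<Longrightarrow> y \<in> N x \<Longrightarrow> y \<notin> node (Q j)"
proof -
  fix i j x y
  assume "st \<le> j" "j < t" "i < par j" "x \<in> node (Q i)" "y \<in> N x"
  then show "y \<notin> node (Q j)" using assms unfolding bfs_def by (metis disjoint_iff)
qed (use assms in \<open>auto simp: bfs_def\<close>)

lemma bfs_par_ge:
  assumes "bfs Q vis par st h t" "st \<le> j" "j < t"
  shows "st \<le> par j"
  using bfs_par_mono[OF assms(1), of st j] bfs_par_start[OF assms(1)] assms by simp

lemma bfs_length: "bfs Q vis par st h t \<Longrightarrow> t \<le> n"
  using queue_length bfs_less bfs_inj by blast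

lemma not_in_node:
  assumes "\<forall>x<n. vis x \<noteq> (0::nat) \<longleftrightarrow> (\<exists>j<t. x \<in> node (Q j))" "\<forall>j<t. Q j < n" "w < n" "vis w = 0" "j < t"
  shows "Q j \<notin> node w" "w \<notin> node (Q j)" "mate w \<notin> node (Q j)" "mate w \<noteq> Q j" "Q j \<noteq> w"
    "mate (Q j) \<noteq> w" "mate (Q j) \<noteq> mate w"
proof -
  show w: "w \<notin> node (Q j)" using assms by blast
  then show "Q j \<notin> node w" using node_sym assms(3) by blast
  then show "mate w \<notin> node (Q j)" "mate w \<noteq> Q j" "Q j \<noteq> w"
    using w mate_mate[OF \<open>w < n\<close>] mate_mate[of "Q j"] assms(2,5) unfolding node_def insert_iff empty_iff by metis+
  then show "mate (Q j) \<noteq> w" "mate (Q j) \<noteq> mate w" using w by (auto simp: node_def)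
qed

text \<open>As its own parent, the start must be separated from all earlier positions, those of
  finished components included. It is, because all their neighbors are visited and the new node is
  not.\<close>

lemma bfs_start:
  assumes s: "searched Q vis t" and u: "u < n" "vis u = 0"
  shows "bfs (Q(t := u)) (vis(u := 1, mate u := 1)) (par(t := t)) t t (Suc t)"
proof -
  have q: "\<forall>j<t. Q j < n" "\<forall>i<t. \<forall>j<t. Q i \<in> node (Q j) \<longrightarrow> i = j"
    "\<forall>x<n. vis x \<noteq> 0 \<longleftrightarrow> (\<exists>j<t. x \<in> node (Q j))" "\<forall>j<t. \<forall>x\<in>node (Q j). \<forall>y\<in>N x. vis y \<noteq> 0"
    using s by (auto simp: searched_def)
  note ni = not_in_node[OF q(3,1) u]
  have vm: "vis (mate u) = 0"
    using q(3) ni(3) mate_less[OF u(1)] by blast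
  have nd: "node ((Q(t := u)) j) = (if j = t then node u else node (Q j))" for j by simp
  have adj: "N x \<inter> node u = {}" if "i < t" "x \<in> node (Q i)" for i x
  proof -
    have "vis y = 0" if "y \<in> node u" for y using that u(2) vm by (auto simp: node_def)
    then show ?thesis using that q(4) by blast
  qed
  show ?thesis
    unfolding bfs_def nd
  proof (intro conjI)
    show "\<forall>i<Suc t. \<forall>j<Suc t. (Q(t := u)) i \<in> (if j = t then node u else node (Q j)) \<longrightarrow> i = j"
      using q(2) ni by (auto simp: less_Suc_eq)
    show "\<forall>x<n. (vis(u := 1, mate u := 1)) x \<noteq> 0 \<longleftrightarrow> (\<exists>j<Suc t. x \<in> (if j = t then node u else node (Q j)))"
      using q(3) by (auto simp: less_Suc_eq node_def)
    show "\<forall>j<t. \<forall>x\<in>if j = t then node u else node (Q j). \<forall>y\<in>N x. (vis(u := 1, mate u := 1)) y \<noteq> 0"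
      using q(4) by auto
  qed (use q u adj in \<open>auto simp: less_Suc_eq\<close>)
qed

text \<open>The positions before \<open>h\<close> are fully scanned, so the node of an unvisited
  \<open>w\<close> has no neighbor there, and \<open>h\<close> is the first position adjacent to it.
  No parent so far exceeds \<open>h\<close>, which keeps the parents monotone.\<close>

lemma bfs_visit:
  assumes b: "bfs Q vis par st h t" and h: "h < t" and x: "x \<in> node (Q h)" "w \<in> N x" and w: "vis w = 0"
  shows "bfs (Q(t := w)) (vis(w := 1, mate w := 1)) (par(t := h)) st h (Suc t)"
proof -
  have q: "st \<le> h" "st < t" "par st = st" "\<forall>j<t. Q j < n" "\<forall>i<t. \<forall>j<t. Q i \<in> node (Q j) \<longrightarrow> i = j"
    "\<forall>x<n. vis x \<noteq> 0 \<longleftrightarrow> (\<exists>j<t. x \<in> node (Q j))" "\<forall>j<h. \<forall>x\<in>node (Q j). \<forall>y\<in>N x. vis y \<noteq> 0"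
    "\<forall>j. st < j \<and> j < t \<longrightarrow> st \<le> par j \<and> par j < j \<and> (\<exists>x\<in>node (Q (par j)). Q j \<in> N x)"
    "\<forall>j. st \<le> j \<and> j < t \<longrightarrow> par j \<le> h"
    "\<forall>i j. st \<le> i \<and> i \<le> j \<and> j < t \<longrightarrow> par i \<le> par j"
    "\<forall>j. st \<le> j \<and> j < t \<longrightarrow> (\<forall>i<par j. \<forall>x\<in>node (Q i). N x \<inter> node (Q j) = {})"
    using b by (auto simp: bfs_def)
  have wn: "w < n" using N_less node_less x q(4) h by blast
  note ni = not_in_node[OF q(6,4) wn w]
  have vm: "vis (mate w) = 0" using q(6) ni(3) mate_less[OF wn] by blast
  have nd: "node ((Q(t := w)) j) = (if j = t then node w else node (Q j))" for j by simp
  have adj: "N x \<inter> node w = {}" if "i < h" "x \<in> node (Q i)" for i x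
  proof -
    have "vis y = 0" if "y \<in> node w" for y using that w vm by (auto simp: node_def)
    then show ?thesis using that q(7) by blast
  qed
  \<comment> \<open>Parents lie below \<open>t\<close>, so writing \<open>w\<close> at position
    \<open>t\<close> leaves the parent nodes unchanged.\<close>
  have sth: "par j < t" if "st < j" "j < t" for j using q(8) that by fastforce
  show ?thesis
    unfolding bfs_def nd
  proof (intro conjI)
    show "\<forall>i<Suc t. \<forall>j<Suc t. (Q(t := w)) i \<in> (if j = t then node w else node (Q j)) \<longrightarrow> i = j"
      using q(5) ni by (auto simp: less_Suc_eq)
    show "\<forall>x<n. (vis(w := 1, mate w := 1)) x \<noteq> 0 \<longleftrightarrow> (\<exists>j<Suc t. x \<in> (if j = t then node w else node (Q j)))"
      using q(6) by (auto simp: less_Suc_eq node_def)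
    show "\<forall>j<h. \<forall>x\<in>if j = t then node w else node (Q j). \<forall>y\<in>N x. (vis(w := 1, mate w := 1)) y \<noteq> 0"
      using q(7) h by auto
    show "\<forall>j. st < j \<and> j < Suc t \<longrightarrow> st \<le> (par(t := h)) j \<and> (par(t := h)) j < j \<and>
        (\<exists>x\<in>if (par(t := h)) j = t then node w else node (Q ((par(t := h)) j)). (Q(t := w)) j \<in> N x)"
      using q(1,8) x h sth by (auto simp: less_Suc_eq)
    show "\<forall>i j. st \<le> i \<and> i \<le> j \<and> j < Suc t \<longrightarrow> (par(t := h)) i \<le> (par(t := h)) j"
      using q(9,10) by (auto simp: less_Suc_eq le_less)
    show "\<forall>j. st \<le> j \<and> j < Suc t \<longrightarrow> (\<forall>i<(par(t := h)) j.
        \<forall>x\<in>if i = t then node w else node (Q i). N x \<inter> (if j = t then node w else node (Q j)) = {})"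
      using q(9,11) adj h by (fastforce simp: less_Suc_eq)
  qed (use q wn h in \<open>auto simp: less_Suc_eq\<close>)
qed

lemma bfs_advance:
  assumes "bfs Q vis par st h t" "h < t" "\<forall>x\<in>node (Q h). \<forall>y\<in>N x. vis y \<noteq> 0"
  shows "bfs Q vis par st (Suc h) t"
  using assms unfolding bfs_def less_Suc_eq
  by (elim conjE, intro conjI) (auto intro: le_SucI)

section \<open>Admissible precolorings and roots\<close>

definition settled :: "(nat \<Rightarrow> nat) \<Rightarrow> (nat \<Rightarrow> nat) \<Rightarrow> nat \<Rightarrow> (nat \<Rightarrow> nat) \<Rightarrow> bool" where
  "settled Q vis st col \<longleftrightarrow> partial col \<and> (\<forall>x<n. vis x = 0 \<longrightarrow> col x = 0) \<and> (\<forall>i<st. col (Q i) \<noteq> 0)"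

text \<open>The last clause confines the precoloring of the component to childless nodes of the
  search tree, so that the uncolored nodes still span a subtree containing \<open>r\<close>.\<close>

definition plan :: "(nat \<Rightarrow> nat) \<Rightarrow> (nat \<Rightarrow> nat) \<Rightarrow> (nat \<Rightarrow> nat) \<Rightarrow> nat \<Rightarrow> nat \<Rightarrow> nat \<Rightarrow> (nat \<Rightarrow> nat) \<Rightarrow> bool" where
  "plan Q vis par st t r col \<longleftrightarrow> settled Q vis st col \<and> st \<le> r \<and> r < t \<and> rootable col (Q r) \<and>
     col (Q r) = 0 \<and> (\<forall>j. st < j \<and> j < t \<longrightarrow> col (Q (par j)) = 0)"

definition fresh :: "(nat \<Rightarrow> nat) \<Rightarrow> (nat \<Rightarrow> nat) \<Rightarrow> nat \<Rightarrow> nat \<Rightarrow> (nat \<Rightarrow> nat) \<Rightarrow> bool" where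
  "fresh Q vis st t col \<longleftrightarrow> settled Q vis st col \<and> (\<forall>i. st \<le> i \<and> i < t \<longrightarrow> col (Q i) = 0)"

lemma partial_node: "partial col \<Longrightarrow> x < n \<Longrightarrow> y \<in> node x \<Longrightarrow> col y = 0 \<longleftrightarrow> col x = 0"
  by (auto simp: partial_def node_def)

text \<open>\<open>low\<close> does not depend on the coloring, and the two witnesses are colored
  while only uncolored vertices change.\<close>

lemma rootable_update:
  assumes "rootable col u" "partial col" "v < n" "col v = 0"
  shows "rootable (col(v := c, mate v := d)) u"
proof -
  have "col (mate v) = 0" using assms by (auto simp: partial_def)
  then have "col y \<noteq> 0 \<Longrightarrow> (col(v := c, mate v := d)) y = col y" for y using assms(4) by auto
  then show ?thesis using assms(1) unfolding rootable_def
    by (metis less_nat_zero_code zero_neq_numeral)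
qed

lemma settled_update:
  assumes s: "settled Q vis st col" and b: "bfs Q vis par st' h t" and j: "j < t"
    and p: "partial (col(Q j := c, mate (Q j) := d))" "c \<noteq> 0" "d \<noteq> 0"
  shows "settled Q vis st (col(Q j := c, mate (Q j) := d))"
proof -
  have "vis (Q j) \<noteq> 0" "vis (mate (Q j)) \<noteq> 0"
    using bfs_vis[OF b] bfs_less[OF b j] j mate_less by (auto simp: node_def)
  then show ?thesis using s p by (auto simp: settled_def)
qed

lemma queue_other:
  assumes b: "bfs Q vis par st h t" and "i < t" "j < t" "i \<noteq> j"
  shows "(col(Q j := c, mate (Q j) := d)) (Q i) = col (Q i)"
proof -
  have "Q i \<notin> node (Q j)" using bfs_inj[OF b] assms by blast
  then show ?thesis by (simp add: node_def)
qed

lemma plan_low: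
  assumes b: "bfs Q vis par st t t" and f: "fresh Q vis st t col" and r: "st \<le> r" "r < t" "low (Q r)"
  shows "plan Q vis par st t r col"
proof -
  have "col (Q (par j)) = 0" if "st < j" "j < t" for j
  proof -
    have "st \<le> par j" "par j < j" using bfs_par_ge[OF b, of j] bfs_par_less[OF b that] that by auto
    then show ?thesis using f that by (auto simp: fresh_def)
  qed
  then show ?thesis using f r by (auto simp: plan_def fresh_def rootable_def)
qed

text \<open>A neighbour of the last node of the queue, other than its parent, was enqueued after that
  parent; as the parents of later nodes come no earlier in the queue, it is childless.\<close>

lemma last_neighbour:
  assumes b: "bfs Q vis par st t t" and x: "x \<in> node (Q (t - 1))" "y \<in> N x"
    and y: "y \<notin> node (Q (t - 1))" "y \<notin> node (Q (par (t - 1)))"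
  obtains i where "st \<le> i" "i < t - 1" "y \<in> node (Q i)" "\<forall>j. st < j \<and> j < t \<longrightarrow> par j \<noteq> i"
proof -
  have t: "st \<le> t - 1" "t - 1 < t" using bfs_bounds[OF b] by auto
  have xn: "x < n" and yn: "y < n" using bfs_less[OF b t(2)] x node_less N_less by blast+
  have "vis y \<noteq> 0" by (rule bfs_closed[OF b t(2) x])
  then obtain i where i: "i < t" "y \<in> node (Q i)" using bfs_vis[OF b yn] by blast
  have "x \<in> N y" using N_sym x xn by blast
  \<comment> \<open>A search parent is the earliest position adjacent to the node of its
    child.\<close>
  then have "\<not> i < par (t - 1)" using bfs_separate[OF b t] x i by blast
  then have ip: "par (t - 1) < i" using i y by (metis linorder_neqE_nat)
  have "st \<le> par (t - 1)" by (rule bfs_par_ge[OF b t])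
  moreover have "i \<noteq> t - 1" using i y by blast
  then have "i < t - 1" using i by simp
  moreover have "par j < i" if "st < j" "j < t" for j
  proof -
    have "par j \<le> par (t - 1)" by (rule bfs_par_mono[OF b]) (use that in auto)
    with ip show ?thesis by simp
  qed
  ultimately show ?thesis using that[of i] ip i by fastforce
qed

text \<open>A component is closed under adjacency: a neighbor at a position before \<open>st\<close>
  would come before the parent of \<open>Q i\<close>, against the separation clause. For
  \<open>y = x\<close> the uniqueness of queue positions is used instead.\<close>

lemma fresh_neighbour:
  assumes b: "bfs Q vis par st t t" and f: "fresh Q vis st t col"
    and i: "st \<le> i" "i < t" "x \<in> node (Q i)" "y \<in> insert x (N x)"
  shows "col y = 0" "y < n" "vis y \<noteq> 0"
proof -
  have xn: "x < n" using bfs_less[OF b i(2)] i node_less by blast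
  then show yn: "y < n" using N_less i(4) by auto
  have col: "partial col" using f by (auto simp: fresh_def settled_def)
  have "vis x \<noteq> 0" using bfs_vis[OF b xn] i(2,3) by blast
  then show "vis y \<noteq> 0" using bfs_closed[OF b i(2,3)] i(4) by blast
  then obtain k where k: "k < t" "y \<in> node (Q k)" using bfs_vis[OF b yn] by blast
  have "st \<le> k"
  proof (rule ccontr)
    assume "\<not> st \<le> k"
    then have ki: "k < par i" "k < i" using bfs_par_ge[OF b i(1,2)] i(1) by auto
    have "x \<noteq> y"
    proof
      assume "x = y"
      then have "node (Q i) = node (Q k)"
        using i k bfs_less[OF b] node_eq[of "Q i" y] node_eq[of "Q k" y] by auto
      then have "Q i \<in> node (Q k)" by (auto simp: node_def)
      then have "i = k" using bfs_inj[OF b i(2) k(1)] by blast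
      with ki show False by simp
    qed
    then have "x \<in> N y" using i(4) N_sym xn by auto
    then show False using bfs_separate[OF b i(1,2) ki(1) k(2)] i(3) by blast
  qed
  moreover have "Q k < n" using b k by (auto simp: bfs_def)
  ultimately show "col y = 0" using f k partial_node[OF col _ k(2)] by (auto simp: fresh_def)
qed

text \<open>Color 3 on \<open>y\<close> and a high color on \<open>z\<close> make the last node
  rootable through \<open>x\<close>. If \<open>z\<close> is the mate of \<open>y\<close>, it already
  has \<open>lam + 3\<close>. Otherwise its node gets \<open>lam + 2\<close> and 1, which clash
  neither with 3 nor with \<open>lam + 3\<close>, whatever edges run between the two nodes.\<close>

lemma plan_two:
  assumes b: "bfs Q vis par st t t" and f: "fresh Q vis st t col"
    and x: "x \<in> node (Q (t - 1))" "mate (Q (t - 1)) \<noteq> Q (t - 1)"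
    and y: "y \<in> N x" "y \<notin> node (Q (t - 1))" "y \<notin> node (Q (par (t - 1)))" "mate y \<noteq> y"
    and z: "z \<in> N x" "z \<notin> node (Q (t - 1))" "z \<notin> node (Q (par (t - 1)))" "mate z \<noteq> z" "y \<noteq> z"
    and col1: "col1 = col(y := 3, mate y := lam + 3)"
    and col2: "col2 = (if col1 z = 0 then col1(z := lam + 2, mate z := 1) else col1)"
  shows "plan Q vis par st t (t - 1) col2"
proof -
  obtain i where i: "st \<le> i" "i < t - 1" "y \<in> node (Q i)" "\<forall>j. st < j \<and> j < t \<longrightarrow> par j \<noteq> i"
    using last_neighbour[OF b x(1) y(1-3)] .
  obtain k where k: "st \<le> k" "k < t - 1" "z \<in> node (Q k)" "\<forall>j. st < j \<and> j < t \<longrightarrow> par j \<noteq> k"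
    using last_neighbour[OF b x(1) z(1-3)] .
  have it: "i < t" "k < t" "t - 1 < t" "st \<le> t - 1" using i k by auto
  note Q = bfs_less[OF b]
  have my: "mate y \<in> node (Q i)" "mate z \<in> node (Q k)"
    using i(3) k(3) Q it by (auto simp: node_def)
  note fy = fresh_neighbour[OF b f i(1) it(1) i(3)] and fmy = fresh_neighbour[OF b f i(1) it(1) my(1)]
  note fz = fresh_neighbour[OF b f k(1) it(2) k(3)] and fmz = fresh_neighbour[OF b f k(1) it(2) my(2)]
  have p: "partial col" using f by (auto simp: fresh_def settled_def)
  have p1: "partial col1" unfolding col1
    by (rule partial_update[OF p]) (use fy fmy y in \<open>auto simp: palette_def far_def\<close>)
  have p2: "partial col2"
  proof (cases "col1 z = 0")
    case True
    have c1: "col1 w \<in> {0, 3, lam + 3}" if "w \<in> N z \<or> w \<in> N (mate z)" for w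
      using that fz(1) fmz(1) by (auto simp: col1)
    have "partial (col1(z := lam + 2, mate z := 1))"
      by (rule partial_update[OF p1]) (use fz True z c1 lam in \<open>fastforce simp: palette_def far_def\<close>)+
    then show ?thesis using True by (simp add: col2)
  qed (use p1 in \<open>simp add: col2\<close>)
  have only: "col2 w = col w" if "w \<notin> node (Q i)" "w \<notin> node (Q k)" for w
    using that i(3) k(3) my by (auto simp: col2 col1)
  have keep: "col2 (Q j) = col (Q j)" if "j < t" "j \<noteq> i" "j \<noteq> k" for j
    using that it bfs_inj[OF b] by (intro only) blast+
  have mono: "col2 w \<noteq> 0" if "col w \<noteq> 0" for w
    using that by (auto simp: col2 col1)
  have root: "rootable col2 (Q (t - 1))"
  proof -
    \<comment> \<open>If \<open>z\<close> is not the mate of \<open>y\<close>, then \<open>y\<close>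
      is not the mate of \<open>z\<close>, so the second update spares the color of
      \<open>y\<close>.\<close>
    have yz: "y \<noteq> mate y" "mate z \<noteq> y \<or> mate y = z" using y z fz(2) by auto
    have "col1 y = 3" using yz by (simp add: col1)
    moreover have "col2 y = 3"
      using yz z(5) lam by (auto simp: col2 col1)
    moreover have "3 < col2 z" using z(4,5) lam yz fz(1)[of z] by (auto simp: col2 col1 split: if_splits)
    ultimately show ?thesis using x y(1) z(1) unfolding rootable_def by blast
  qed
  have "settled Q vis st col2"
    unfolding settled_def
  proof (intro conjI allI impI)
    fix w assume w: "w < n" "vis w = 0"
    then have "w \<notin> node (Q i)" "w \<notin> node (Q k)" using bfs_vis[OF b] it by blast+
    then show "col2 w = 0" using only f w by (auto simp: fresh_def settled_def)
  qed (use p2 mono f in \<open>auto simp: fresh_def settled_def\<close>)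
  moreover have "col2 (Q (par j)) = 0" if "st < j" "j < t" for j
  proof -
    have "st \<le> par j" "par j < t" using bfs_par_ge[OF b, of j] bfs_par_less[OF b that] that by auto
    then show ?thesis using keep[of "par j"] i(4) k(4) that f by (auto simp: fresh_def)
  qed
  moreover have "col2 (Q (t - 1)) = 0" using keep[of "t - 1"] i k it f by (auto simp: fresh_def)
  ultimately show ?thesis using root it by (auto simp: plan_def)
qed

text \<open>A common neighbor \<open>p\<close> of both ends sees 3 and \<open>lam + 3\<close>, which
  makes the parent node rootable. The precolored node is the last one of the queue, hence childless,
  and \<open>st < t - 1\<close> makes it different from its parent.\<close>

lemma plan_parent:
  assumes b: "bfs Q vis par st t t" and f: "fresh Q vis st t col"
    and a: "a = Q (t - 1)" "mate a \<noteq> a" and st: "st < t - 1"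
    and p: "p \<in> node (Q (par (t - 1)))" "p \<in> N a" "p \<in> N (mate a)"
  shows "plan Q vis par st t (par (t - 1)) (col(a := 3, mate a := lam + 3))"
proof -
  let ?c = "col(a := 3, mate a := lam + 3)"
  have t: "t - 1 < t" "st \<le> t - 1" using st by auto
  have an: "a \<in> node (Q (t - 1))" "mate a \<in> node (Q (t - 1))" "a < n"
    using a bfs_less[OF b] t by (auto simp: node_def)
  note fa = fresh_neighbour[OF b f t(2,1) an(1)] and fma = fresh_neighbour[OF b f t(2,1) an(2)]
  have pc: "partial col" using f by (auto simp: fresh_def settled_def)
  have p1: "partial ?c"
    by (rule partial_update[OF pc]) (use fa fma a in \<open>auto simp: palette_def far_def\<close>)
  have pt: "st \<le> par j" "par j < t - 1" if "st < j" "j < t" for j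
    using bfs_par_ge[OF b, of j] bfs_par_less[OF b that] that by auto
  have keep: "?c (Q j) = col (Q j)" if "j < t - 1" for j
    unfolding a by (rule queue_other[OF b]) (use that in auto)
  have "settled Q vis st ?c" unfolding a
    by (rule settled_update[OF _ b t(1)]) (use f p1 a in \<open>auto simp: fresh_def\<close>)
  moreover have "rootable ?c (Q (par (t - 1)))"
  proof -
    have "a \<in> N p" "mate a \<in> N p" using p N_sym an mate_less by auto
    then show ?thesis using p a lam unfolding rootable_def by (metis fun_upd_apply less_add_same_cancel2 zero_less_iff_neq_zero not_numeral_le_zero)
  qed
  moreover have "?c (Q (par j)) = 0" if "st < j" "j < t" for j
    using keep[OF pt(2)[OF that]] pt[OF that] f by (auto simp: fresh_def)
  moreover have "st \<le> par (t - 1)" "par (t - 1) < t" using pt[OF st t(1)] by auto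
  ultimately show ?thesis
    using st t by (simp add: plan_def)
qed

section \<open>The two coloring passes\<close>

text \<open>The marked positions \<open>sk i \<noteq> 0\<close> are the part found so far of the tree path from the root
  \<open>r\<close> of the coloring to the start \<open>st\<close> of the search.\<close>

definition backward ::
  "(nat \<Rightarrow> nat) \<Rightarrow> (nat \<Rightarrow> nat) \<Rightarrow> (nat \<Rightarrow> nat) \<Rightarrow> nat \<Rightarrow> nat \<Rightarrow> nat \<Rightarrow> (nat \<Rightarrow> nat) \<Rightarrow> (nat \<Rightarrow> nat) \<Rightarrow> nat \<Rightarrow> bool" where
  "backward Q vis par st t r sk col j \<longleftrightarrow> settled Q vis st col \<and> st \<le> j \<and> j \<le> t \<and>
     st \<le> r \<and> r < t \<and> rootable col (Q r) \<and>
     (\<forall>i. st < i \<and> i < t \<and> par i < j \<longrightarrow> col (Q (par i)) = 0) \<and>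
     (\<forall>i. st \<le> i \<and> i < t \<and> sk i \<noteq> 0 \<longrightarrow> col (Q i) = 0) \<and>
     (\<forall>i. j \<le> i \<and> i < t \<and> sk i = 0 \<longrightarrow> col (Q i) \<noteq> 0) \<and>
     (\<forall>i. st \<le> i \<and> i < t \<and> sk i \<noteq> 0 \<and> i \<noteq> r \<longrightarrow> (\<exists>k. i < k \<and> k < t \<and> sk k \<noteq> 0 \<and> par k = i)) \<and>
     ((\<exists>i. st \<le> i \<and> i < j \<and> sk i \<noteq> 0) \<or> sk st \<noteq> 0) \<and>
     (\<forall>i. t \<le> i \<and> i < n \<longrightarrow> sk i = 0)"

text \<open>The backward pass leaves only the marked path uncolored, which is now colored from
  \<open>st\<close> towards \<open>r\<close>. Marks from position \<open>t\<close> on are excluded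
  so that the next component starts with none.\<close>

definition forward ::
  "(nat \<Rightarrow> nat) \<Rightarrow> (nat \<Rightarrow> nat) \<Rightarrow> (nat \<Rightarrow> nat) \<Rightarrow> nat \<Rightarrow> nat \<Rightarrow> nat \<Rightarrow> (nat \<Rightarrow> nat) \<Rightarrow> (nat \<Rightarrow> nat) \<Rightarrow> nat \<Rightarrow> bool" where
  "forward Q vis par st t r sk col j \<longleftrightarrow> settled Q vis j col \<and> st \<le> j \<and> j \<le> t \<and>
     st \<le> r \<and> r < t \<and> rootable col (Q r) \<and>
     (\<forall>i. j \<le> i \<and> i < t \<longrightarrow> (sk i \<noteq> 0 \<longleftrightarrow> col (Q i) = 0)) \<and>
     (\<forall>i. st \<le> i \<and> i < t \<and> sk i \<noteq> 0 \<and> i \<noteq> r \<longrightarrow> (\<exists>k. i < k \<and> k < t \<and> sk k \<noteq> 0 \<and> par k = i)) \<and>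
     (\<forall>i. t \<le> i \<and> i < n \<longrightarrow> sk i = 0)"

lemma settled_partial: "settled Q vis st col \<Longrightarrow> partial col"
  by (simp add: settled_def)

lemma backward_start:
  assumes "bfs Q vis par st t t" "plan Q vis par st t r col" "\<forall>i. st \<le> i \<and> i < n \<longrightarrow> sk i = 0"
  shows "backward Q vis par st t r (sk(r := 1)) col t"
  using assms bfs_bounds[OF assms(1)] bfs_length[OF assms(1)] unfolding backward_def plan_def by auto

text \<open>The backward pass colors children before their parents; the parent is the uncolored
  neighbor that guarantees a choice.\<close>

lemma waiting_parent:
  assumes b: "bfs Q vis par st t t" and j: "st < j" "j < t" and c: "partial col" "col (Q (par j)) = 0"
  shows "waiting col (Q j)"
proof -
  have pj: "par j < j" "par j < t" using bfs_par_less[OF b j] j by auto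
  obtain x where x: "x \<in> node (Q (par j))" "Q j \<in> N x" using bfs_par_edge[OF b j] by blast
  have xn: "x < n" using x(1) bfs_less[OF b pj(2)] node_less by blast
  have "x \<in> N (Q j)" using N_sym[OF xn x(2)] .
  moreover have "col x = 0" using partial_node[OF c(1) bfs_less[OF b pj(2)] x(1)] c(2) by simp
  moreover have "x \<notin> node (Q j)"
  proof
    assume "x \<in> node (Q j)"
    then have "node (Q (par j)) = node (Q j)"
      using node_eq[OF bfs_less[OF b pj(2)] x(1)] node_eq[OF bfs_less[OF b j(2)]] by simp
    then have "Q (par j) \<in> node (Q j)" by (auto simp: node_def)
    then show False using bfs_inj[OF b pj(2) j(2)] pj by simp
  qed
  ultimately show ?thesis unfolding waiting_def node_def by blast
qed

lemma backwardD:
  assumes "backward Q vis par st t r sk col j"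
  shows "settled Q vis st col" "st \<le> j" "j \<le> t" "st \<le> r" "r < t" "rootable col (Q r)"
    and "\<And>i. st < i \<Longrightarrow> i < t \<Longrightarrow> par i < j \<Longrightarrow> col (Q (par i)) = 0"
    and "\<And>i. st \<le> i \<Longrightarrow> i < t \<Longrightarrow> sk i \<noteq> 0 \<Longrightarrow> col (Q i) = 0"
    and "\<And>i. j \<le> i \<Longrightarrow> i < t \<Longrightarrow> sk i = 0 \<Longrightarrow> col (Q i) \<noteq> 0"
    and "\<And>i. st \<le> i \<Longrightarrow> i < t \<Longrightarrow> sk i \<noteq> 0 \<Longrightarrow> i \<noteq> r \<Longrightarrow> \<exists>k. i < k \<and> k < t \<and> sk k \<noteq> 0 \<and> par k = i"
    and "(\<exists>i. st \<le> i \<and> i < j \<and> sk i \<noteq> 0) \<or> sk st \<noteq> 0"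
    and "\<And>i. t \<le> i \<Longrightarrow> i < n \<Longrightarrow> sk i = 0"
  using assms unfolding backward_def by blast+

text \<open>A marked position passes its mark to its parent instead of being colored, so the marks
  follow the tree path from \<open>r\<close> to \<open>st\<close>. At \<open>st\<close> the mark
  falls on \<open>st\<close> itself, as \<open>par st = st\<close>; elsewhere \<open>j\<close> is
  the later marked child that the new mark requires.\<close>

lemma backward_mark:
  assumes b: "bfs Q vis par st t t" and i: "backward Q vis par st t r sk col (Suc j)" "st \<le> j" "sk j \<noteq> 0"
  shows "backward Q vis par st t r (sk(par j := 1)) col j"
proof -
  note D = backwardD[OF i(1)]
  have j: "j < t" using D(3) by simp
  have pj: "st \<le> par j" "par j < t" "st < j \<and> par j < j \<or> j = st \<and> par j = st"
    using bfs_par_ge[OF b i(2) j] bfs_par_less[OF b _ j] bfs_par_start[OF b] i(2) j by (cases "st = j"; force)+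
  have root: "col (Q (par j)) = 0"
    using pj(3) D(7)[of j] D(8)[of j] i(2,3) j by auto
  show ?thesis
    unfolding backward_def
  proof (intro conjI allI impI)
    fix k assume k: "st \<le> k \<and> k < t \<and> (sk(par j := 1)) k \<noteq> 0 \<and> k \<noteq> r"
    show "\<exists>l. k < l \<and> l < t \<and> (sk(par j := 1)) l \<noteq> 0 \<and> par l = k"
    proof (cases "sk k \<noteq> 0")
      case True
      then obtain l where "k < l" "l < t" "sk l \<noteq> 0" "par l = k" using D(10)[of k] k by blast
      then show ?thesis by (intro exI[of _ l]) auto
    next
      case False
      then have "k = par j" using k by (simp split: if_splits)
      then show ?thesis using False pj(3) i(3) j by (intro exI[of _ j]) auto
    qed
  next
    show "(\<exists>k. st \<le> k \<and> k < j \<and> (sk(par j := 1)) k \<noteq> 0) \<or> (sk(par j := 1)) st \<noteq> 0"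
      using pj(1,3) by auto
  next
    fix k assume k: "j \<le> k \<and> k < t \<and> (sk(par j := 1)) k = 0"
    then have "k \<noteq> j" using i(3) by (auto split: if_splits)
    then show "col (Q k) \<noteq> 0" using D(9)[of k] k by (auto split: if_splits)
  next
    fix k assume "st \<le> k \<and> k < t \<and> (sk(par j := 1)) k \<noteq> 0"
    then show "col (Q k) = 0" using D(8)[of k] root by (auto split: if_splits)
  qed (use D i j pj in \<open>auto\<close>)
qed

lemma backward_skip:
  assumes i: "backward Q vis par st t r sk col (Suc j)" "st \<le> j" "sk j = 0" "col (Q j) \<noteq> 0"
  shows "backward Q vis par st t r sk col j"
proof -
  note D = backwardD[OF i(1)]
  have "(\<exists>k. st \<le> k \<and> k < j \<and> sk k \<noteq> 0) \<or> sk st \<noteq> 0"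
    using D(11) i(3) by (metis less_Suc_eq)
  moreover have "col (Q k) \<noteq> 0" if "j \<le> k" "k < t" "sk k = 0" for k
    using D(9)[of k] that i(4) by (cases "k = j") auto
  ultimately show ?thesis
    using D(1-8,10,12) i(2) unfolding backward_def by auto
qed

text \<open>Either a mark still lies ahead or \<open>st\<close> is marked, so an unmarked position
  is not \<open>st\<close>. It has a proper parent, which this pass has not reached yet.\<close>

lemma backward_waiting:
  assumes b: "bfs Q vis par st t t" and i: "backward Q vis par st t r sk col (Suc j)" "st \<le> j" "sk j = 0"
  shows "waiting col (Q j)"
proof -
  note D = backwardD[OF i(1)]
  have "j \<noteq> st" using D(11) i(3) by (metis less_Suc_eq not_less)
  then have j: "st < j" "j < t" using i(2) D(3) by auto
  then have "col (Q (par j)) = 0" using D(7)[of j] bfs_par_less[OF b j] by simp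
  then show ?thesis using waiting_parent[OF b j settled_partial[OF D(1)]] by simp
qed

lemma backward_color:
  assumes b: "bfs Q vis par st t t" and i: "backward Q vis par st t r sk col (Suc j)" "st \<le> j"
      "sk j = 0" "col (Q j) = 0"
    and p: "partial (col(Q j := c, mate (Q j) := d))" "c \<noteq> 0" "d \<noteq> 0"
  shows "backward Q vis par st t r sk (col(Q j := c, mate (Q j) := d)) j"
proof -
  define col' where "col' = col(Q j := c, mate (Q j) := d)"
  note D = backwardD[OF i(1)]
  have j: "j < t" using D(3) by simp
  have keep: "col' (Q k) = col (Q k)" if "k < t" "k \<noteq> j" for k
    unfolding col'_def by (rule queue_other[OF b that(1) j that(2)])
  have "settled Q vis st col'" "rootable col' (Q r)"
    using settled_update[OF D(1) b j p]
      rootable_update[OF D(6) settled_partial[OF D(1)] bfs_less[OF b j] i(4)] by (simp_all add: col'_def)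
  moreover have "col' (Q j) \<noteq> 0" using p(2,3) by (simp add: col'_def)
  moreover have "(\<exists>k. st \<le> k \<and> k < j \<and> sk k \<noteq> 0) \<or> sk st \<noteq> 0"
    using D(11) i(3) by (metis less_Suc_eq)
  moreover have "col' (Q k) = 0" if "st \<le> k" "k < t" "sk k \<noteq> 0" for k
    using keep[of k] D(8)[OF that] that i(3) by metis
  moreover have "col' (Q (par k)) = 0" if "st < k" "k < t" "par k < j" for k
    using keep[of "par k"] D(7)[of k] that j by simp
  moreover have "col' (Q k) \<noteq> 0" if "j \<le> k" "k < t" "sk k = 0" for k
    using keep[of k] D(9)[of k] that \<open>col' (Q j) \<noteq> 0\<close> by (cases "k = j") auto
  ultimately show ?thesis
    using D(2-5,10,12) i(2) j unfolding backward_def col'_def[symmetric] by auto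
qed

lemma forward_start:
  assumes b: "bfs Q vis par st t t" and i: "backward Q vis par st t r sk col st"
  shows "forward Q vis par st t r sk col st"
  using assms unfolding backward_def forward_def by auto

lemma forward_skip:
  assumes "forward Q vis par st t r sk col j" "j < t" "col (Q j) \<noteq> 0"
  shows "forward Q vis par st t r sk col (Suc j)"
  using assms unfolding forward_def settled_def by (auto simp: less_Suc_eq)

text \<open>The next marked node on the path towards \<open>r\<close> is adjacent and still
  uncolored; \<open>r\<close> itself is rootable.\<close>

lemma forward_ready:
  assumes b: "bfs Q vis par st t t" and i: "forward Q vis par st t r sk col j" "j < t" "col (Q j) = 0"
  shows "rootable col (Q j) \<or> waiting col (Q j)"
proof (cases "j = r")
  case True then show ?thesis using i by (auto simp: forward_def)
next
  case False
  have st: "st \<le> j" using i by (auto simp: forward_def)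
  have "sk j \<noteq> 0" using i unfolding forward_def by blast
  then obtain k where k: "j < k" "k < t" "sk k \<noteq> 0" "par k = j"
    using i False st unfolding forward_def by blast
  have "col (Q k) = 0" using i k unfolding forward_def by auto
  have col: "partial col" using i by (auto simp: forward_def settled_def)
  obtain x where x: "x \<in> node (Q j)" "Q k \<in> N x" using bfs_par_edge[OF b, of k] k st by auto
  have "Q k \<notin> node (Q j)" using bfs_inj[OF b k(2) i(2)] k(1) by auto
  then show ?thesis using x \<open>col (Q k) = 0\<close> unfolding waiting_def by blast
qed

lemma forward_color:
  assumes b: "bfs Q vis par st t t" and i: "forward Q vis par st t r sk col j" "j < t" "col (Q j) = 0"
    and p: "partial (col(Q j := c, mate (Q j) := d))" "c \<noteq> 0" "d \<noteq> 0"
  shows "forward Q vis par st t r sk (col(Q j := c, mate (Q j) := d)) (Suc j)"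
proof -
  define col' where "col' = col(Q j := c, mate (Q j) := d)"
  have D: "settled Q vis j col" "rootable col (Q r)" "\<And>k. j \<le> k \<Longrightarrow> k < t \<Longrightarrow> sk k \<noteq> 0 \<longleftrightarrow> col (Q k) = 0"
    using i(1) by (auto simp: forward_def)
  have keep: "col' (Q k) = col (Q k)" if "k < t" "k \<noteq> j" for k
    unfolding col'_def by (rule queue_other[OF b that(1) i(2) that(2)])
  have "settled Q vis j col'" "rootable col' (Q r)"
    using settled_update[OF D(1) b i(2) p]
      rootable_update[OF D(2) settled_partial[OF D(1)] bfs_less[OF b i(2)] i(3)] by (simp_all add: col'_def)
  moreover have "col' (Q j) \<noteq> 0" using p(2,3) by (simp add: col'_def)
  ultimately have "settled Q vis (Suc j) col'" by (auto simp: settled_def less_Suc_eq)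
  moreover have "sk k \<noteq> 0 \<longleftrightarrow> col' (Q k) = 0" if "Suc j \<le> k" "k < t" for k
    using keep[of k] D(3)[of k] that by simp
  ultimately show ?thesis
    using i(1,2) \<open>rootable col' (Q r)\<close> unfolding forward_def col'_def[symmetric] by auto
qed

lemma settled_searched:
  assumes s: "searched Q vis t" and c: "settled Q vis t col" and x: "x < n"
  shows "col x = 0 \<longleftrightarrow> vis x = 0"
proof
  assume "col x = 0"
  show "vis x = 0"
  proof (rule ccontr)
    assume "vis x \<noteq> 0"
    then obtain j where j: "j < t" "x \<in> node (Q j)" using s x by (auto simp: searched_def)
    then have "col (Q j) = 0"
      using partial_node[OF settled_partial[OF c], of "Q j" x] \<open>col x = 0\<close> s by (auto simp: searched_def)
    then show False using c j by (auto simp: settled_def)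
  qed
qed (use c x in \<open>auto simp: settled_def\<close>)

end

section \<open>The program\<close>

definition nbr :: "aexp \<Rightarrow> nat \<Rightarrow> aexp" where
  "nbr e d = Read ''G_adj'' (add_const (Read ''G_off'' e) d)"

definition has_nbr :: "aexp \<Rightarrow> nat \<Rightarrow> bexp" where
  "has_nbr e d = Less (add_const (Read ''G_off'' e) d) (Read ''G_off'' (Succ e))"

definition mate_of :: "aexp \<Rightarrow> aexp" where
  "mate_of e = Read ''mate'' e"

text \<open>Degrees are at most four, so the four adjacency slots are tested without a loop; an
  absent slot forbids nothing.\<close>

definition free :: "aexp \<Rightarrow> aexp \<Rightarrow> bexp" where
  "free e c = all_of (map (\<lambda>d. Not (And (has_nbr e d) (Equal (Read ''color'' (nbr e d)) c))) [0..<4])"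

definition set_node :: "aexp \<Rightarrow> aexp \<Rightarrow> aexp \<Rightarrow> com" where
  "set_node e c d = Seq (Write ''color'' e c) (Write ''color'' (mate_of e) d)"

definition high :: "nat \<Rightarrow> aexp" where
  "high k = add_const (Reg ''lambda'') k"

definition palette_exps :: "aexp list" where
  "palette_exps = map Const [1, 2, 3] @ map high [1, 2, 3]"

definition far_exps :: "(aexp \<times> aexp) list" where
  "far_exps = (let ps = [(1, 1), (1, 2), (1, 3), (2, 2), (2, 3), (3, 3)]
     in map (\<lambda>(i, k). (Const i, high k)) ps @ map (\<lambda>(i, k). (high k, Const i)) ps)"

definition color_node :: com where
  "color_node = If (Equal (mate_of (Reg ''u'')) (Reg ''u''))
     (chain (map (\<lambda>c. (free (Reg ''u'') c, set_node (Reg ''u'') c c)) palette_exps) Skip)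
     (chain (map (\<lambda>(c, d). (And (free (Reg ''u'') c) (free (mate_of (Reg ''u'')) d), set_node (Reg ''u'') c d))
        far_exps) Skip)"

text \<open>\<open>tail\<close> is advanced last: the written positions, and \<open>p\<close> when a
  search starts, refer to its old value.\<close>

definition enqueue :: "aexp \<Rightarrow> aexp \<Rightarrow> com" where
  "enqueue e p = seqs [Write ''vis'' e (Const 1), Write ''vis'' (mate_of e) (Const 1),
     Write ''par'' (Reg ''tail'') p, Write ''queue'' (Reg ''tail'') e, Assign ''tail'' (Succ (Reg ''tail''))]"

definition scan_step :: "aexp \<Rightarrow> nat \<Rightarrow> com" where
  "scan_step e d = If (has_nbr e d) (Seq (Assign ''w'' (nbr e d))
     (If (Equal (Read ''vis'' (Reg ''w'')) (Const 0)) (enqueue (Reg ''w'') (Reg ''head'')) Skip)) Skip"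

definition scan :: "aexp \<Rightarrow> com" where
  "scan e = seqs (map (scan_step e) [0..<4])"

definition full :: "aexp \<Rightarrow> bexp" where
  "full e = Equal (add_const (Read ''G_off'' e) 4) (Read ''G_off'' (Succ e))"

definition low_test :: bexp where
  "low_test = Not (all_of [Not (Equal (mate_of (Reg ''u'')) (Reg ''u'')), full (Reg ''u''), full (mate_of (Reg ''u''))])"

definition bfs_body :: com where
  "bfs_body = seqs [Assign ''u'' (Read ''queue'' (Reg ''head'')),
     If low_test (Seq (Assign ''root'' (Reg ''head'')) (Assign ''low'' (Const 1))) Skip,
     scan (Reg ''u''), scan (mate_of (Reg ''u'')), Assign ''head'' (Succ (Reg ''head''))]"

definition outside :: "aexp \<Rightarrow> bexp" where
  "outside e = all_of (map (\<lambda>x. Not (Equal e (Reg x))) [''a'', ''b'', ''p'', ''q''])"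

definition move :: "name \<Rightarrow> nat \<Rightarrow> nat \<Rightarrow> com" where
  "move x d d' = seqs [Assign ''y'' (nbr (Reg x) d), Assign ''z'' (nbr (Reg x) d'),
     set_node (Reg ''y'') (Const 3) (high 3),
     If (Equal (Read ''color'' (Reg ''z'')) (Const 0)) (set_node (Reg ''z'') (high 2) (Const 1)) Skip,
     Assign ''root'' (Pred (Reg ''tail''))]"

definition moves :: "(name \<times> nat \<times> nat) list" where
  "moves = List.product [''a'', ''b''] [(0, 1), (0, 2), (0, 3), (1, 2), (1, 3), (2, 3)]"

definition two_outside :: "(bexp \<times> com) list" where
  "two_outside = map (\<lambda>(x, d, d').
     (And (outside (nbr (Reg x) d)) (outside (nbr (Reg x) d')), move x d d')) moves"

lemma moves: "(x, d, d') \<in> set moves \<longleftrightarrow> x \<in> {''a'', ''b''} \<and> d < d' \<and> d' < 4"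
proof -
  have *: "d < d' \<and> d' < 4 \<longleftrightarrow> d = 0 \<and> d' = 1 \<or> d = 0 \<and> d' = 2 \<or> d = 0 \<and> d' = 3 \<or> d = 1 \<and> d' = 2 \<or>
      d = 1 \<and> d' = 3 \<or> d = 2 \<and> d' = 3"
    by presburger
  show ?thesis unfolding *
    by (cases "x = ''a''"; cases "x = ''b''"; simp add: moves_def)
qed

text \<open>A nonzero \<open>low\<close> means that \<open>root\<close> already holds the position
  of a low node. Otherwise the chain tries all pairs of neighbors of either end of the last node, as
  in \<open>plan_two\<close>; its default branch is the precoloring of
  \<open>plan_parent\<close>.\<close>

definition choose_root :: com where
  "choose_root = If (Equal (Reg ''low'') (Const 0))
     (seqs [Assign ''a'' (Read ''queue'' (Pred (Reg ''tail''))), Assign ''b'' (mate_of (Reg ''a'')),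
        Assign ''p'' (Read ''queue'' (Read ''par'' (Pred (Reg ''tail'')))), Assign ''q'' (mate_of (Reg ''p'')),
        chain two_outside
          (Seq (set_node (Reg ''a'') (Const 3) (high 3)) (Assign ''root'' (Read ''par'' (Pred (Reg ''tail'')))))])
     Skip"

definition color_next :: com where
  "color_next = If (Equal (Read ''color'' (Reg ''u'')) (Const 0)) color_node Skip"

text \<open>\<open>j\<close> is decreased before use, so the loop visits the positions from
  \<open>tail - 1\<close> down to \<open>st\<close>.\<close>

definition backward_body :: com where
  "backward_body = seqs [Assign ''j'' (Pred (Reg ''j'')), Assign ''u'' (Read ''queue'' (Reg ''j'')),
     If (Equal (Read ''skip'' (Reg ''j'')) (Const 0)) color_next
       (Write ''skip'' (Read ''par'' (Reg ''j'')) (Const 1))]"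

definition forward_body :: com where
  "forward_body = seqs [Assign ''u'' (Read ''queue'' (Reg ''j'')), color_next,
     Assign ''j'' (Succ (Reg ''j''))]"

definition open_component :: com where
  "open_component = seqs [Assign ''st'' (Reg ''tail''), Assign ''head'' (Reg ''tail''),
     Assign ''low'' (Const 0), enqueue (Reg ''i'') (Reg ''tail'')]"

definition close_component :: com where
  "close_component = seqs [choose_root, Write ''skip'' (Reg ''root'') (Const 1), Assign ''j'' (Reg ''tail'')]"

definition component :: com where
  "component = Seq open_component (Seq (While (Less (Reg ''head'') (Reg ''tail'')) bfs_body)
     (Seq close_component (Seq (While (Less (Reg ''st'') (Reg ''j'')) backward_body)
       (While (Less (Reg ''j'') (Reg ''tail'')) forward_body))))"

definition outer_body :: com where
  "outer_body = Seq (If (Equal (Read ''vis'' (Reg ''i'')) (Const 0)) component Skip)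
     (Assign ''i'' (Succ (Reg ''i'')))"

text \<open>Memory is arbitrary at the start, hence the clearing. The backbone is a matching, so the
  first entry of a nonempty backbone list is the only partner; an empty list makes the vertex its
  own mate.\<close>

definition init_body :: com where
  "init_body = seqs [Write ''color'' (Reg ''i'') (Const 0), Write ''vis'' (Reg ''i'') (Const 0),
     Write ''skip'' (Reg ''i'') (Const 0),
     If (Less (Read ''H_off'' (Reg ''i'')) (Read ''H_off'' (Succ (Reg ''i''))))
       (Write ''mate'' (Reg ''i'') (Read ''H_adj'' (Read ''H_off'' (Reg ''i''))))
       (Write ''mate'' (Reg ''i'') (Reg ''i'')),
     Assign ''i'' (Succ (Reg ''i''))]"

definition main :: com where
  "main = Seq (Assign ''i'' (Const 0)) (Seq (Assign ''tail'' (Const 0))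
     (Seq (While (Less (Reg ''i'') (Reg ''n'')) init_body) (Seq (Assign ''i'' (Const 0))
       (While (Less (Reg ''i'') (Reg ''n'')) outer_body))))"

lemma aval_simps [simp]:
  "aval (nbr e d) s = arr s ''G_adj'' (arr s ''G_off'' (aval e s) + d)"
  "aval (mate_of e) s = arr s ''mate'' (aval e s)"
  "aval (high k) s = reg s ''lambda'' + k"
  by (simp_all add: nbr_def mate_of_def high_def)

lemma bval_has_nbr [simp]:
  "bval (has_nbr e d) s \<longleftrightarrow> arr s ''G_off'' (aval e s) + d < arr s ''G_off'' (aval e s + 1)"
  by (simp add: has_nbr_def)

lemma loopfree_simps [simp]:
  "loopfree (set_node e c d)" "loopfree color_node" "loopfree (enqueue e p)" "loopfree (scan e)"
  "loopfree bfs_body" "loopfree choose_root" "loopfree color_next" "loopfree backward_body"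
  "loopfree forward_body" "loopfree open_component" "loopfree close_component" "loopfree init_body"
  by (auto simp: set_node_def color_node_def enqueue_def scan_def scan_step_def bfs_body_def
      choose_root_def two_outside_def moves_def move_def color_next_def backward_body_def forward_body_def
      open_component_def close_component_def init_body_def)

lemma wregs_simps:
  "wregs (set_node e c d) = {}" "wregs color_node = {}" "wregs (enqueue e p) = {''tail''}"
  "wregs (scan e) = {''w'', ''tail''}" "wregs bfs_body = {''u'', ''root'', ''low'', ''w'', ''tail'', ''head''}"
  "wregs choose_root = {''a'', ''b'', ''p'', ''q'', ''y'', ''z'', ''root''}" "wregs color_next = {}"
  "wregs backward_body = {''j'', ''u''}" "wregs forward_body = {''j'', ''u''}"
  "wregs open_component = {''st'', ''head'', ''low'', ''tail''}"
  "wregs close_component = {''a'', ''b'', ''p'', ''q'', ''y'', ''z'', ''root'', ''j''}"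
  "wregs init_body = {''i''}"
  by (auto simp: set_node_def color_node_def enqueue_def scan_def scan_step_def bfs_body_def
      choose_root_def two_outside_def moves_def move_def color_next_def backward_body_def forward_body_def
      open_component_def close_component_def init_body_def)

lemma warrs_simps:
  "warrs (set_node e c d) = {''color''}" "warrs color_node = {''color''}"
  "warrs (enqueue e p) = {''vis'', ''par'', ''queue''}"
  "warrs (scan e) = {''vis'', ''par'', ''queue''}" "warrs bfs_body = {''vis'', ''par'', ''queue''}"
  "warrs choose_root = {''color''}" "warrs color_next = {''color''}"
  "warrs backward_body = {''color'', ''skip''}" "warrs forward_body = {''color''}"
  "warrs open_component = {''vis'', ''par'', ''queue''}"
  "warrs close_component = {''color'', ''skip''}"
  "warrs init_body = {''color'', ''vis'', ''skip'', ''mate''}"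
  by (auto simp: set_node_def color_node_def enqueue_def scan_def scan_step_def bfs_body_def
      choose_root_def two_outside_def moves_def move_def color_next_def backward_body_def forward_body_def
      open_component_def close_component_def init_body_def palette_exps_def far_exps_def)

lemma den_chain_hit:
  assumes "(b, p) \<in> set xs" "bval b s"
  obtains b' p' where "(b', p') \<in> set xs" "bval b' s" "den (chain xs q) s = den p' s"
  using den_chain[of xs s q] assms by blast

context backbone_graph
begin

section \<open>Meaning of the tests and effect of coloring a node\<close>

definition input :: "state \<Rightarrow> bool" where
  "input s \<longleftrightarrow> reg s ''n'' = n \<and> reg s ''lambda'' = lam \<and> (\<forall>x<n. arr s ''mate'' x = mate x) \<and>
     (\<forall>x<n. arr s ''G_off'' x \<le> arr s ''G_off'' (x + 1) \<and>
        bij_betw (arr s ''G_adj'') {arr s ''G_off'' x..<arr s ''G_off'' (x + 1)} (N x))"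

lemma inputD:
  assumes "input s"
  shows input_n: "reg s ''n'' = n" and input_lam: "reg s ''lambda'' = lam"
    and input_mate: "x < n \<Longrightarrow> arr s ''mate'' x = mate x"
    and input_card: "x < n \<Longrightarrow> arr s ''G_off'' (Suc x) = arr s ''G_off'' x + card (N x)"
  using assms bij_betw_same_card[of "arr s ''G_adj''" "{arr s ''G_off'' x..<arr s ''G_off'' (x + 1)}" "N x"]
  by (auto simp: input_def)

lemma input_nbrs:
  assumes "input s" "x < n"
  shows "N x = {arr s ''G_adj'' (arr s ''G_off'' x + d) | d. d < card (N x)}"
proof -
  have "N x = arr s ''G_adj'' ` {arr s ''G_off'' x..<arr s ''G_off'' x + card (N x)}"
  proof -
    have "arr s ''G_adj'' ` {arr s ''G_off'' x..<arr s ''G_off'' (x + 1)} = N x"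
      using assms unfolding input_def bij_betw_def by blast
    then show ?thesis using input_card[OF assms] by simp
  qed
  then show ?thesis
    by (force simp: image_iff le_iff_add)
qed

lemma input_nbr_inj:
  assumes "input s" "x < n" "d < card (N x)" "d' < card (N x)" "d \<noteq> d'"
  shows "arr s ''G_adj'' (arr s ''G_off'' x + d) \<noteq> arr s ''G_adj'' (arr s ''G_off'' x + d')"
  using assms(1,2,5) input_card[OF assms(1,2)] assms(3,4)
  unfolding input_def bij_betw_def inj_on_def by fastforce

lemma bval_free:
  assumes "input s" "aval e s < n"
  shows "bval (free e c) s \<longleftrightarrow> (\<forall>y\<in>N (aval e s). arr s ''color'' y \<noteq> aval c s)"
  using card_N[OF assms(2)] input_card[OF assms]
  by (subst input_nbrs[OF assms]) (force simp: free_def)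

lemma bval_low:
  assumes "input s" "reg s ''u'' < n"
  shows "bval low_test s \<longleftrightarrow> low (reg s ''u'')"
  using assms input_card[OF assms(1)] input_mate[OF assms] mate_less[OF assms(2)]
  by (auto simp: low_test_def low_def full_def)

lemma palette_exps: "reg s ''lambda'' = lam \<Longrightarrow> (\<lambda>c. aval c s) ` set palette_exps = palette"
  by (auto simp: palette_exps_def palette_def)

lemma far_exps: "reg s ''lambda'' = lam \<Longrightarrow>
  (\<lambda>(c, d). (aval c s, aval d s)) ` set far_exps = {(c, d). c \<in> palette \<and> d \<in> palette \<and> far c d}"
proof -
  assume l: "reg s ''lambda'' = lam"
  define ps :: "(nat \<times> nat) set" where "ps = {(1, lam + 1), (1, lam + 2), (1, lam + 3), (2, lam + 2), (2, lam + 3), (3, lam + 3)}"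
  have "(\<lambda>(c, d). (aval c s, aval d s)) ` set far_exps = ps \<union> prod.swap ` ps"
    by (simp add: far_exps_def ps_def l insert_commute)
  also have "\<dots> = {(c, d). c \<in> palette \<and> d \<in> palette \<and> far c d}"
  proof (intro set_eqI iffI)
    fix x assume "x \<in> {(c, d). c \<in> palette \<and> d \<in> palette \<and> far c d}"
    then obtain c d where x: "x = (c, d)" "c \<in> palette" "d \<in> palette" "far c d" by auto
    have in_ps: "(c, d) \<in> ps" if "c \<in> palette" "d \<in> palette" "lam + c \<le> d" for c d
    proof -
      \<comment> \<open>Together with \<open>lam + c \<le> d\<close> these bounds make
        \<open>c\<close> low and \<open>d\<close> high.\<close>
      have "1 \<le> c" "d \<le> lam + 3" using that by (auto simp: palette_def)
      then have "c = 1 \<or> c = 2 \<or> c = 3" "d = lam + 1 \<or> d = lam + 2 \<or> d = lam + 3"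
        using that(3) by linarith+
      then show ?thesis using that(3) by (elim disjE) (simp_all add: ps_def)
    qed
    have "(c, d) \<in> ps \<or> (d, c) \<in> ps" using in_ps[OF x(2,3)] in_ps[OF x(3,2)] x(4) by (auto simp: far_def)
    then show "x \<in> ps \<union> prod.swap ` ps" using x(1) by force
  next
    fix x assume "x \<in> ps \<union> prod.swap ` ps"
    then show "x \<in> {(c, d). c \<in> palette \<and> d \<in> palette \<and> far c d}"
      by (auto simp: ps_def palette_def far_def)
  qed
  finally show ?thesis .
qed

text \<open>\<open>set_node\<close> evaluates its second color only after the first write, which
  must not affect it.\<close>

lemma aval_color_independent:
  "c \<in> set palette_exps \<Longrightarrow> aval c (set_arr ''color'' i k s) = aval c s"
  "(c, d) \<in> set far_exps \<Longrightarrow> aval d (set_arr ''color'' i k s) = aval d s"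
  by (auto simp: palette_exps_def far_exps_def)

text \<open>A legal choice exists, so some guard of the chain holds. The branch taken may belong to
  another choice, but its guard certifies that one as well.\<close>

lemma den_color_node:
  assumes s: "input s" and u: "u = reg s ''u''" "u < n" and col: "col = arr s ''color''" "partial col" "col u = 0"
    and ok: "rootable col u \<or> waiting col u"
  obtains c d where "c \<noteq> 0" "d \<noteq> 0" "partial (col(u := c, mate u := d))"
    "den color_node s = set_arr ''color'' (mate u) d (set_arr ''color'' u c s)"
proof -
  have m: "arr s ''mate'' u = mate u" using input_mate[OF s u(2)] .
  have l: "reg s ''lambda'' = lam" using input_lam[OF s] .
  have "\<exists>c d. c \<in> palette \<and> d \<in> palette \<and> (if mate u = u then c = d else far c d) \<and> (\<forall>y\<in>N u. col y \<noteq> c) \<and>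
      (\<forall>y\<in>N (mate u). col y \<noteq> d) \<and>
      den color_node s = set_arr ''color'' (mate u) d (set_arr ''color'' u c s)"
  proof (cases "mate u = u")
    case True
    let ?xs = "map (\<lambda>c. (free (Reg ''u'') c, set_node (Reg ''u'') c c)) palette_exps"
    have den: "den color_node s = den (chain ?xs Skip) s" using True m u by (simp add: color_node_def)
    have fr: "bval (free (Reg ''u'') c) s \<longleftrightarrow> (\<forall>y\<in>N u. col y \<noteq> aval c s)" for c
      using bval_free[OF s, of "Reg ''u''" c] u col by simp
    obtain c where c: "c \<in> palette" "\<forall>y\<in>N u. col y \<noteq> c" using single_choice[OF col(2) u(2)] by blast
    then obtain ce where "ce \<in> set palette_exps" "aval ce s = c"
      unfolding palette_exps[OF l, symmetric] by blast
    then have "(free (Reg ''u'') ce, set_node (Reg ''u'') ce ce) \<in> set ?xs" "bval (free (Reg ''u'') ce) s"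
      using c fr by auto
    from den_chain_hit[OF this, of Skip, folded den] obtain b p where
      bp: "(b, p) \<in> set ?xs" "bval b s" "den color_node s = den p s" .
    then obtain e where e: "e \<in> set palette_exps" "\<forall>y\<in>N u. col y \<noteq> aval e s"
      "den color_node s = den (set_node (Reg ''u'') e e) s"
      using fr by auto
    have "aval e s \<in> palette" using palette_exps[OF l] e(1) by blast
    moreover have "den color_node s = set_arr ''color'' (mate u) (aval e s) (set_arr ''color'' u (aval e s) s)"
      using e(3) m u aval_color_independent(1)[OF e(1)] by (simp add: set_node_def)
    ultimately show ?thesis using e(2) True by auto
  next
    case False
    let ?xs = "map (\<lambda>(c, d). (And (free (Reg ''u'') c) (free (mate_of (Reg ''u'')) d),
      set_node (Reg ''u'') c d)) far_exps"
    have den: "den color_node s = den (chain ?xs Skip) s" using False m u by (simp add: color_node_def)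
    have fr: "bval (free (Reg ''u'') c) s \<longleftrightarrow> (\<forall>y\<in>N u. col y \<noteq> aval c s)"
      "bval (free (mate_of (Reg ''u'')) c) s \<longleftrightarrow> (\<forall>y\<in>N (mate u). col y \<noteq> aval c s)" for c
      using bval_free[OF s, of "Reg ''u''" c] bval_free[OF s, of "mate_of (Reg ''u'')" c] u col m mate_less by auto
    obtain c d where c: "c \<in> palette" "d \<in> palette" "far c d" "\<forall>y\<in>N u. col y \<noteq> c" "\<forall>y\<in>N (mate u). col y \<noteq> d"
      using pair_choice[OF col(2) u(2) False col(3) ok] by blast
    then have "(c, d) \<in> (\<lambda>(c, d). (aval c s, aval d s)) ` set far_exps" unfolding far_exps[OF l] by simp
    then obtain ce de where "(ce, de) \<in> set far_exps" "aval ce s = c" "aval de s = d" by auto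
    then have "(And (free (Reg ''u'') ce) (free (mate_of (Reg ''u'')) de), set_node (Reg ''u'') ce de) \<in> set ?xs"
      "bval (And (free (Reg ''u'') ce) (free (mate_of (Reg ''u'')) de)) s"
      using c fr by force+
    from den_chain_hit[OF this, of Skip, folded den] obtain b p where
      bp: "(b, p) \<in> set ?xs" "bval b s" "den color_node s = den p s" .
    from bp(1) obtain e f where ef: "(e, f) \<in> set far_exps"
      "b = And (free (Reg ''u'') e) (free (mate_of (Reg ''u'')) f)" "p = set_node (Reg ''u'') e f"
      by auto
    then have e: "(e, f) \<in> set far_exps" "\<forall>y\<in>N u. col y \<noteq> aval e s" "\<forall>y\<in>N (mate u). col y \<noteq> aval f s"
      "den color_node s = den (set_node (Reg ''u'') e f) s"
      using bp(2,3) fr by auto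
    have "(aval e s, aval f s) \<in> {(c, d). c \<in> palette \<and> d \<in> palette \<and> far c d}"
      unfolding far_exps[OF l, symmetric] using e(1) by force
    moreover have "den color_node s = set_arr ''color'' (mate u) (aval f s) (set_arr ''color'' u (aval e s) s)"
      using e(4) m u aval_color_independent(2)[OF e(1)] by (simp add: set_node_def)
    ultimately show ?thesis using e(2,3) False by auto
  qed
  then obtain c d where cd: "c \<in> palette" "d \<in> palette" "if mate u = u then c = d else far c d"
    "\<forall>y\<in>N u. col y \<noteq> c" "\<forall>y\<in>N (mate u). col y \<noteq> d"
    "den color_node s = set_arr ''color'' (mate u) d (set_arr ''color'' u c s)" by blast
  have "partial (col(u := c, mate u := d))"
    by (rule partial_update[OF col(2) u(2) col(3) cd(1,2)]) (use cd in auto)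
  moreover have "c \<noteq> 0" "d \<noteq> 0" using cd(1,2) by (auto simp: palette_def)
  ultimately show ?thesis using that cd(6) by blast
qed

lemma den_color_next:
  assumes s: "input s" and u: "u = reg s ''u''" "u < n" and col: "col = arr s ''color''" "partial col"
    and ok: "col u = 0 \<Longrightarrow> rootable col u \<or> waiting col u"
  shows "den color_next s = s \<and> col u \<noteq> 0 \<or> (\<exists>c d. col u = 0 \<and> c \<noteq> 0 \<and> d \<noteq> 0 \<and> partial (col(u := c, mate u := d)) \<and>
    den color_next s = set_arr ''color'' (mate u) d (set_arr ''color'' u c s))"
proof (cases "col u = 0")
  case True
  from den_color_node[OF s u col True ok[OF True]] obtain c d where
    "c \<noteq> 0" "d \<noteq> 0" "partial (col(u := c, mate u := d))"
    "den color_node s = set_arr ''color'' (mate u) d (set_arr ''color'' u c s)" .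
  then show ?thesis using True u col by (auto simp: color_next_def)
qed (use u col in \<open>auto simp: color_next_def\<close>)


section \<open>Correctness of the search\<close>

text \<open>The parameters freeze the adjacency arrays, the scanned vertex and the first
  \<open>t\<close> queue entries during both scans; \<open>Y\<close> grows by the neighbors
  handled.\<close>

definition scanning ::
  "(nat \<Rightarrow> nat) \<Rightarrow> (nat \<Rightarrow> nat) \<Rightarrow> nat \<Rightarrow> (nat \<Rightarrow> nat) \<Rightarrow> nat \<Rightarrow> nat set \<Rightarrow> state \<Rightarrow> bool" where
  "scanning off adj u Q t Y s \<longleftrightarrow> input s \<and> arr s ''G_off'' = off \<and> arr s ''G_adj'' = adj \<and>
     reg s ''u'' = u \<and> reg s ''head'' < reg s ''tail'' \<and> arr s ''queue'' (reg s ''head'') = u \<and>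
     bfs (arr s ''queue'') (arr s ''vis'') (arr s ''par'') (reg s ''st'') (reg s ''head'') (reg s ''tail'') \<and>
     t \<le> reg s ''tail'' \<and> (\<forall>j<t. arr s ''queue'' j = Q j) \<and> (\<forall>y\<in>Y. arr s ''vis'' y \<noteq> 0)"

lemma scan_step:
  assumes s: "scanning off adj u Q t Y s"
    and e: "e = Reg ''u'' \<and> x = u \<or> e = mate_of (Reg ''u'') \<and> x = mate u"
    and d: "off x + d < off (Suc x)"
  shows "scanning off adj u Q t (insert (adj (off x + d)) Y) (den (scan_step e d) s)"
proof -
  define w where "w = adj (off x + d)"
  have i: "input s" and b: "bfs (arr s ''queue'') (arr s ''vis'') (arr s ''par'') (reg s ''st'') (reg s ''head'') (reg s ''tail'')"
    and h: "reg s ''head'' < reg s ''tail''" and a: "arr s ''G_off'' = off" "arr s ''G_adj'' = adj" "reg s ''u'' = u"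
      "arr s ''queue'' (reg s ''head'') = u"
    using s by (auto simp: scanning_def)
  have u: "u < n" using bfs_less[OF b h] a by simp
  have x: "x \<in> node u" "x < n" using e u mate_less by (auto simp: node_def)
  have ex: "aval e s = x" using e a input_mate[OF i u] by auto
  have w: "w \<in> N x" using d input_nbrs[OF i x(2)] input_card[OF i x(2)] a unfolding w_def by auto
  then have wn: "w < n" using N_less x by blast
  have mw: "arr s ''mate'' w = mate w" using input_mate[OF i wn] .
  let ?s = "set_reg ''w'' w s"
  have den: "den (scan_step e d) s = (if arr s ''vis'' w = 0 then den (enqueue (Reg ''w'') (Reg ''head'')) ?s else ?s)"
    using ex a d by (simp add: scan_step_def w_def)
  show ?thesis
  proof (cases "arr s ''vis'' w = 0")
    case False
    then show ?thesis using s unfolding den w_def[symmetric] by (auto simp: scanning_def input_def)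
  next
    case True
    have "bfs ((arr s ''queue'')(reg s ''tail'' := w)) ((arr s ''vis'')(w := 1, mate w := 1))
      ((arr s ''par'')(reg s ''tail'' := reg s ''head'')) (reg s ''st'') (reg s ''head'') (Suc (reg s ''tail''))"
      by (rule bfs_visit[OF b h _ w True]) (use x a in simp)
    then show ?thesis using s True mw unfolding den w_def[symmetric]
      by (auto simp: scanning_def input_def enqueue_def)
  qed
qed

lemma den_scan:
  assumes s: "scanning off adj u Q t Y s"
    and e: "e = Reg ''u'' \<and> x = u \<or> e = mate_of (Reg ''u'') \<and> x = mate u"
  shows "scanning off adj u Q t (Y \<union> N x) (den (scan e) s)"
proof -
  \<comment> \<open>\<open>Z d\<close> adds the first \<open>d\<close> slots; four slots exhaust the
    neighbors.\<close>
  define Z where "Z d = Y \<union> {adj (off x + k) | k. k < d \<and> off x + k < off (Suc x)}" for d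
  have i: "input s" and b: "bfs (arr s ''queue'') (arr s ''vis'') (arr s ''par'') (reg s ''st'') (reg s ''head'') (reg s ''tail'')"
    and a: "arr s ''G_off'' = off" "arr s ''G_adj'' = adj" "reg s ''head'' < reg s ''tail''" "arr s ''queue'' (reg s ''head'') = u"
    using s by (auto simp: scanning_def)
  have u: "u < n" using bfs_less[OF b a(3)] a by simp
  have x: "x < n" using e u mate_less by auto
  have "scanning off adj u Q t (Z 4) (den (scan e) s)"
    unfolding scan_def
  proof (rule den_seqs_upt)
    show "scanning off adj u Q t (Z 0) s" using s by (simp add: Z_def)
  next
    fix d s assume d: "scanning off adj u Q t (Z d) s"
    show "scanning off adj u Q t (Z (Suc d)) (den (scan_step e d) s)"
    proof (cases "off x + d < off (Suc x)")
      case True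
      have "Z (Suc d) = insert (adj (off x + d)) (Z d)" using True by (auto simp: Z_def less_Suc_eq)
      then show ?thesis using scan_step[OF d e True] by simp
    next
      case False
      have i: "input s" "reg s ''u'' = u" "arr s ''G_off'' = off" using d by (auto simp: scanning_def)
      have "aval e s = x" using e i input_mate[OF i(1) u] by auto
      then have "den (scan_step e d) s = s" using False i by (simp add: scan_step_def)
      moreover have "Z (Suc d) = Z d" using False by (auto simp: Z_def less_Suc_eq)
      ultimately show ?thesis using d by simp
    qed
  qed
  moreover have "Z 4 = Y \<union> N x"
  proof -
    have "k < 4 \<and> off x + k < off (Suc x) \<longleftrightarrow> k < card (N x)" for k
      using input_card[OF i x] card_N[OF x] a by auto
    then show ?thesis using input_nbrs[OF i x] a by (simp add: Z_def)
  qed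
  ultimately show ?thesis by simp
qed

text \<open>\<open>l \<noteq> 0\<close> records that a node which can serve as root was found, at position \<open>r\<close>.\<close>

definition low_info :: "(nat \<Rightarrow> nat) \<Rightarrow> nat \<Rightarrow> nat \<Rightarrow> nat \<Rightarrow> nat \<Rightarrow> nat \<Rightarrow> bool" where
  "low_info Q st h t l r \<longleftrightarrow>
     (if l = 0 then \<forall>j. st \<le> j \<and> j < h \<longrightarrow> \<not> low (Q j) else st \<le> r \<and> r < t \<and> low (Q r))"

text \<open>\<open>Q\<close> pins the queue up to and including \<open>st\<close>: finished
  components and the start of the current search stay in place.\<close>

definition searching :: "(nat \<Rightarrow> nat) \<Rightarrow> state \<Rightarrow> bool" where
  "searching Q s \<longleftrightarrow> input s \<and>
     bfs (arr s ''queue'') (arr s ''vis'') (arr s ''par'') (reg s ''st'') (reg s ''head'') (reg s ''tail'') \<and>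
     (\<forall>j\<le>reg s ''st''. arr s ''queue'' j = Q j) \<and>
     low_info (arr s ''queue'') (reg s ''st'') (reg s ''head'') (reg s ''tail'') (reg s ''low'') (reg s ''root'')"

lemma searching_step:
  assumes s: "searching Q s" and h: "reg s ''head'' < reg s ''tail''"
  shows "searching Q (den bfs_body s)" "reg (den bfs_body s) ''head'' = Suc (reg s ''head'')"
proof -
  define q st hd t where "q = arr s ''queue''" "st = reg s ''st''" "hd = reg s ''head''" "t = reg s ''tail''"
  define u where "u = q hd"
  have i: "input s" and b: "bfs q (arr s ''vis'') (arr s ''par'') st hd t" "hd < t"
    and Q: "\<forall>j\<le>st. q j = Q j" and l: "low_info q st hd t (reg s ''low'') (reg s ''root'')"
    using s h by (auto simp: searching_def q_st_hd_t_def)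
  have u: "u < n" using bfs_less[OF b] by (simp add: u_def)
  define s1 where "s1 = den (If low_test (Seq (Assign ''root'' (Reg ''head'')) (Assign ''low'' (Const 1))) Skip)
    (set_reg ''u'' u s)"
  define s2 where "s2 = den (scan (Reg ''u'')) s1"
  define s3 where "s3 = den (scan (mate_of (Reg ''u''))) s2"
  have den: "den bfs_body s = set_reg ''head'' (Suc (reg s3 ''head'')) s3"
    by (simp add: bfs_body_def s1_def s2_def s3_def u_def q_st_hd_t_def)
  have "input (set_reg ''u'' u s)" using i by (simp add: input_def)
  then have lt: "bval low_test (set_reg ''u'' u s) \<longleftrightarrow> low u" using bval_low[of "set_reg ''u'' u s"] u by simp
  have s1: "arr s1 = arr s" "reg s1 ''n'' = reg s ''n''" "reg s1 ''lambda'' = reg s ''lambda''"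
    "reg s1 ''st'' = st" "reg s1 ''head'' = hd" "reg s1 ''tail'' = t"
    by (auto simp: s1_def q_st_hd_t_def)
  have l1: "low_info q st (Suc hd) t (reg s1 ''low'') (reg s1 ''root'')" "reg s1 ''u'' = u"
    using l lt b bfs_bounds[OF b(1)] by (auto simp: s1_def low_info_def u_def q_st_hd_t_def less_Suc_eq)
  have "scanning (arr s ''G_off'') (arr s ''G_adj'') u q t {} s1"
  proof -
    have "input s1" using i s1 by (simp add: input_def)
    moreover have "q hd = u" by (simp add: u_def)
    ultimately show ?thesis using b l1(2) s1 by (simp add: scanning_def flip: q_st_hd_t_def(1))
  qed
  then have sc: "scanning (arr s ''G_off'') (arr s ''G_adj'') u q t ({} \<union> N u \<union> N (mate u)) s3"
    unfolding s3_def s2_def by (intro den_scan) auto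
  have fr: "reg s3 x = reg s1 x" if "x \<notin> {''w'', ''tail''}" for x
    using frame_reg[OF frame_den[of "scan (Reg ''u'')" s1], of x] that
      frame_reg[OF frame_den[of "scan (mate_of (Reg ''u''))" s2], of x] by (simp add: wregs_simps s2_def s3_def)
  have r3: "reg s3 ''st'' = st" "reg s3 ''head'' = hd" "reg s3 ''low'' = reg s1 ''low''" "reg s3 ''root'' = reg s1 ''root''"
    by (simp_all add: fr s1 q_st_hd_t_def)
  have q3: "t \<le> reg s3 ''tail''" "\<forall>j<t. arr s3 ''queue'' j = q j" "input s3" "hd < reg s3 ''tail''"
    "bfs (arr s3 ''queue'') (arr s3 ''vis'') (arr s3 ''par'') st hd (reg s3 ''tail'')"
    "\<forall>y\<in>N u \<union> N (mate u). arr s3 ''vis'' y \<noteq> 0" "arr s3 ''queue'' hd = u"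
    using sc r3 by (auto simp: scanning_def)
  have b3: "bfs (arr s3 ''queue'') (arr s3 ''vis'') (arr s3 ''par'') st (Suc hd) (reg s3 ''tail'')"
    by (rule bfs_advance[OF q3(5,4)]) (use q3 in \<open>auto simp: node_def\<close>)
  have "low_info (arr s3 ''queue'') st (Suc hd) (reg s3 ''tail'') (reg s1 ''low'') (reg s1 ''root'')"
    using l1(1) q3(1,2) b(2) by (auto simp: low_info_def split: if_splits)
  moreover have "\<forall>j\<le>st. arr s3 ''queue'' j = Q j" using Q q3(2) bfs_bounds[OF b(1)] by auto
  ultimately show "searching Q (den bfs_body s)"
    using b3 q3(3) r3 by (simp add: den searching_def input_def)
  show "reg (den bfs_body s) ''head'' = Suc (reg s ''head'')" using r3 by (simp add: den q_st_hd_t_def)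
qed


section \<open>Choice of the root\<close>

text \<open>Neither \<open>x\<close> nor \<open>p\<close> is a neighbor of \<open>x\<close>, so of
  the four neighbors at most \<open>mate x\<close> and \<open>q\<close> are excluded.\<close>

lemma last_two:
  assumes x: "x < n" "card (N x) = 4" and p: "p \<notin> N x"
  obtains y z where "y \<in> N x" "z \<in> N x" "y \<noteq> z" "{y, z} \<inter> {x, mate x, p, q} = {}"
proof -
  have "card (N x) \<le> card (N x - {mate x, q}) + card {mate x, q}"
    by (metis card_Un_le finite_N[OF x(1)] Un_Diff_cancel2 card_mono finite_Un finite.emptyI finite.insertI le_trans sup_ge1 finite_Diff)
  moreover have "card {mate x, q} \<le> 2" by (simp add: card_insert_if)
  ultimately have "\<not> card (N x - {mate x, q}) \<le> Suc 0" using x(2) by simp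
  then obtain y z where "y \<in> N x - {mate x, q}" "z \<in> N x - {mate x, q}" "y \<noteq> z"
    using card_le_Suc0_iff_eq[of "N x - {mate x, q}"] finite_N[OF x(1)] by blast
  then show ?thesis using that[of y z] p N_irrefl[OF x(1)] by blast
qed

text \<open>Without a low node, the component consists of matched pairs of degree-4 vertices. If
  neither end of the last node has two neighbors outside that node and its parent, then by
  \<open>last_two\<close> the vertex \<open>p\<close> of the parent is adjacent to both
  ends.\<close>

lemma den_choose_root:
  assumes i: "input s" and Q: "Q = arr s ''queue''" "vis = arr s ''vis''" "par = arr s ''par''"
      "st = reg s ''st''" "t = reg s ''tail''" "col = arr s ''color''"
    and b: "bfs Q vis par st t t" and f: "fresh Q vis st t col"
    and l: "low_info Q st t t (reg s ''low'') (reg s ''root'')"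
  shows "plan Q vis par st t (reg (den choose_root s) ''root'') (arr (den choose_root s) ''color'')"
proof (cases "reg s ''low'' = 0")
  case False
  then show ?thesis using l Q plan_low[OF b f] by (auto simp: choose_root_def low_info_def)
next
  case True
  define a p where "a = Q (t - 1)" "p = Q (par (t - 1))"
  have t: "st \<le> t - 1" "t - 1 < t" "t - Suc 0 < t" using bfs_bounds[OF b] by auto
  have a: "a < n" using bfs_less[OF b t(2)] by (simp add: a_p_def)
  have "par (t - 1) < t" using bfs_par_less[OF b, of "t - 1"] bfs_par_start[OF b] t by (cases "st = t - 1") auto
  then have p: "p < n" using bfs_less[OF b] by (simp add: a_p_def)
  have nl: "\<not> low (Q j)" if "st \<le> j" "j < t" for j using l True that by (simp add: low_info_def)
  have na: "mate a \<noteq> a" "card (N a) = 4" "card (N (mate a)) = 4" using nl[OF t(1,2)] by (auto simp: low_def a_p_def)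
  define s1 where "s1 = set_reg ''q'' (mate p) (set_reg ''p'' p (set_reg ''b'' (mate a) (set_reg ''a'' a s)))"
  define els where "els = Seq (set_node (Reg ''a'') (Const 3) (high 3)) (Assign ''root'' (Read ''par'' (Pred (Reg ''tail''))))"
  have den: "den choose_root s = den (chain two_outside els) s1"
    using True Q input_mate[OF i a] input_mate[OF i p] by (simp add: choose_root_def s1_def els_def a_p_def)
  have arr1: "arr s1 = arr s" "reg s1 ''a'' = a" "reg s1 ''b'' = mate a" "reg s1 ''tail'' = t" "reg s1 ''lambda'' = lam"
    using Q input_lam[OF i] by (simp_all add: s1_def)
  have out: "bval (outside e) s1 \<longleftrightarrow> aval e s1 \<notin> {a, mate a, p, mate p}" for e
    by (simp add: outside_def s1_def)
  define nb where "nb x d = arr s ''G_adj'' (arr s ''G_off'' x + d)" for x d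
  have nbN: "N x = {nb x d | d. d < 4}" if "x \<in> {a, mate a}" for x
    using input_nbrs[OF i, of x] that na a mate_less[OF a] by (auto simp: nb_def)
  have nb_inj: "nb x d \<noteq> nb x d'" if "x \<in> {a, mate a}" "d < 4" "d' < 4" "d \<noteq> d'" for x d d'
    using input_nbr_inj[OF i, of x d d'] that na a mate_less[OF a] by (auto simp: nb_def)
  \<comment> \<open>Neighbors lie in the current component, which has no low and hence no unmatched
    node.\<close>
  have nm: "mate y \<noteq> y" if "x \<in> {a, mate a}" "y \<in> N x" for x y
  proof -
    have "x \<in> node (Q (t - 1))" using that(1) by (auto simp: node_def a_p_def)
    then have vy: "vis y \<noteq> 0" "y < n" using fresh_neighbour[OF b f t(1,2)] that(2) by auto
    then obtain k where k: "k < t" "y \<in> node (Q k)" using bfs_vis[OF b] by blast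
    show ?thesis
    proof (cases "st \<le> k")
      case True
      then show ?thesis using nl[OF True k(1)] k(2) bfs_less[OF b k(1)] by (auto simp: low_def node_def)
    next
      case False
      \<comment> \<open>\<open>y\<close> is located anew: in the last node, in its parent or, by
        \<open>last_neighbour\<close>, elsewhere in the component.\<close>
      have "y \<in> node (Q (t - 1)) \<or> y \<in> node (Q (par (t - 1))) \<or> (\<exists>i\<ge>st. i < t \<and> y \<in> node (Q i))"
        using last_neighbour[OF b \<open>x \<in> node (Q (t - 1))\<close> that(2)]
        by (metis less_imp_diff_less order.strict_trans1 t(2) less_imp_le nat_less_le)
      moreover have "st \<le> par (t - 1)" "par (t - 1) < t" using bfs_par_ge[OF b t(1,2)] \<open>par (t - 1) < t\<close> by auto
      ultimately obtain i where i: "st \<le> i" "i < t" "y \<in> node (Q i)" using t by blast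
      then show ?thesis using nl[OF i(1,2)] bfs_less[OF b i(2)] by (auto simp: low_def node_def)
    qed
  qed
  from den_chain[of two_outside s1 els] show ?thesis
  proof
    assume "\<exists>(g, c)\<in>set two_outside. bval g s1 \<and> den (chain two_outside els) s1 = den c s1"
    then obtain g c where gc: "(g, c) \<in> set two_outside" "bval g s1" "den choose_root s = den c s1"
      using den by auto
    then obtain m where m: "m \<in> set moves" "(g, c) = (case m of (x, d, d') \<Rightarrow>
        (And (outside (nbr (Reg x) d)) (outside (nbr (Reg x) d')), move x d d'))"
      unfolding two_outside_def by auto
    obtain x d d' where "m = (x, d, d')" by (cases m)
    with m have x: "x \<in> {''a'', ''b''}" "d < 4" "d' < 4" "d \<noteq> d'"
      "g = And (outside (nbr (Reg x) d)) (outside (nbr (Reg x) d'))" "c = move x d d'"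
      using moves[of x d d'] by auto
    define X y z where "X = reg s1 x" "y = nb (reg s1 x) d" "z = nb (reg s1 x) d'"
    have X: "X \<in> {a, mate a}" using x(1) by (auto simp: X_y_z_def arr1)
    have yz: "y \<in> N X" "z \<in> N X" "y \<noteq> z" using nbN[OF X] nb_inj[OF X x(2-4)] x by (auto simp: X_y_z_def)
    have Xn: "X < n" using X a mate_less by auto
    have yzn: "y < n" "z < n" using yz N_less[OF Xn] by auto
    have o: "y \<notin> {a, mate a, p, mate p}" "z \<notin> {a, mate a, p, mate p}"
      using gc(2) x(5) out by (auto simp: X_y_z_def nb_def arr1)
    define col1 where "col1 = col(y := 3, mate y := lam + 3)"
    define col2 where "col2 = (if col1 z = 0 then col1(z := lam + 2, mate z := 1) else col1)"
    have "arr (den c s1) ''color'' = col2" "reg (den c s1) ''root'' = t - 1"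
    proof -
      have x': "x \<noteq> ''y''" "x \<noteq> ''z''" using x(1) by auto
      have "arr (den c s1) ''color'' = col2 \<and> reg (den c s1) ''root'' = t - 1"
        using x' input_mate[OF i yzn(1)] input_mate[OF i yzn(2)] arr1 Q
        by (simp add: x(6) move_def set_node_def col2_def col1_def X_y_z_def nb_def)
      then show "arr (den c s1) ''color'' = col2" "reg (den c s1) ''root'' = t - 1" by auto
    qed
    moreover have "plan Q vis par st t (t - 1) col2"
      by (rule plan_two[OF b f _ _ yz(1) _ _ _ yz(2) _ _ _ yz(3) col1_def col2_def])
        (use X o nm[OF X yz(1)] nm[OF X yz(2)] na in \<open>auto simp: node_def a_p_def\<close>)
    ultimately show ?thesis using gc(3) by simp
  next
    assume "(\<forall>(g, c)\<in>set two_outside. \<not> bval g s1) \<and> den (chain two_outside els) s1 = den els s1"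
    then have no: "\<forall>(g, c)\<in>set two_outside. \<not> bval g s1" and de: "den choose_root s = den els s1" using den by auto
    have pN: "p \<in> N X" if X: "X = a \<and> x = ''a'' \<or> X = mate a \<and> x = ''b''" for X x
    proof (rule ccontr)
      assume np: "p \<notin> N X"
      have Xm: "X \<in> {a, mate a}" "X < n" "card (N X) = 4" "mate X \<in> {a, mate a}" "{X, mate X} = {a, mate a}"
        using X a na mate_less[OF a] by auto
      \<comment> \<open>Every increasing pair of slots occurs in \<open>moves\<close>, so a pair
        leading outside would have passed its test.\<close>
      have nab: "False" if "d < d'" "d' < 4" "nb X d \<notin> {a, mate a, p, mate p}" "nb X d' \<notin> {a, mate a, p, mate p}" for d d'
      proof -
        have "(x, d, d') \<in> set moves" using that(1,2) X by (auto simp: moves)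
        then have "(And (outside (nbr (Reg x) d)) (outside (nbr (Reg x) d')), move x d d') \<in> set two_outside"
          unfolding two_outside_def by force
        then have "\<not> bval (And (outside (nbr (Reg x) d)) (outside (nbr (Reg x) d'))) s1"
          using no by blast
        moreover have "reg s1 x = X" using X arr1 by auto
        ultimately show False using that(3,4) by (simp add: out nb_def arr1(1))
      qed
      obtain y z where yz: "y \<in> N X" "z \<in> N X" "y \<noteq> z" "{y, z} \<inter> {X, mate X, p, mate p} = {}"
        using last_two[OF Xm(2,3) np] .
      then obtain d d' where d: "d < 4" "d' < 4" "y = nb X d" "z = nb X d'" using nbN[OF Xm(1)] by auto
      have eq: "{X, mate X, p, mate p} = {a, mate a, p, mate p}"
        using X mate_mate[OF a] by (elim disjE conjE) (simp_all add: insert_commute)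
      have "y \<notin> {a, mate a, p, mate p}" "z \<notin> {a, mate a, p, mate p}" using yz(4) unfolding eq by blast+
      then show False using nab[of d d'] nab[of d' d] d yz(3) by (cases d d' rule: linorder_cases) auto
    qed
    have "p \<in> N a" "p \<in> N (mate a)" using pN by auto
    \<comment> \<open>If the last node were the start, it would be its own parent, and
      \<open>p = a\<close> would be adjacent to itself.\<close>
    moreover have "st < t - 1"
    proof (rule ccontr)
      assume "\<not> st < t - 1"
      then have "p = a" using t(1) bfs_par_start[OF b] by (simp add: a_p_def)
      then show False using \<open>p \<in> N a\<close> N_irrefl[OF a] by simp
    qed
    moreover have "arr (den els s1) ''color'' = col(a := 3, mate a := lam + 3)" "reg (den els s1) ''root'' = par (t - 1)"
      using arr1 Q input_mate[OF i a] by (simp_all add: els_def set_node_def)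
    ultimately show ?thesis
      using plan_parent[OF b f, of a p] na(1) de by (simp add: a_p_def node_def)
  qed
qed

end

section \<open>Cost constants\<close>

definition component_cost :: nat where
  "component_cost = mcost open_component + mcost close_component +
     iter_cost (Less (Reg ''head'') (Reg ''tail'')) bfs_body +
     iter_cost (Less (Reg ''st'') (Reg ''j'')) backward_body +
     iter_cost (Less (Reg ''j'') (Reg ''tail'')) forward_body"

text \<open>A component with \<open>m\<close> new nodes costs at most
  \<open>component_cost * (m + 1)\<close>, and \<open>m + 1 \<le> 2 * m\<close>; hence the factor 2.
  The 4 collects the unit costs of the branch, of \<open>Skip\<close>, of the assignment and of the
  loop test.\<close>

definition outer_cost :: nat where
  "outer_cost = bcost (Equal (Read ''vis'' (Reg ''i'')) (Const 0)) + acost (Succ (Reg ''i'')) +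
     bcost (Less (Reg ''i'') (Reg ''n'')) + 4 + 2 * component_cost"

text \<open>The 6 pays for three assignments; \<open>2 * outer_cost\<close> comes from the initial
  potential \<open>outer_cost * (n + n)\<close> of the outermost loop.\<close>

definition main_cost :: nat where
  "main_cost = 6 + iter_cost (Less (Reg ''i'') (Reg ''n'')) init_body + 2 * outer_cost +
     bcost (Less (Reg ''i'') (Reg ''n'')) + 1"

context backbone_graph
begin

section \<open>Correctness of the coloring\<close>

definition passing ::
  "((nat \<Rightarrow> nat) \<Rightarrow> (nat \<Rightarrow> nat) \<Rightarrow> (nat \<Rightarrow> nat) \<Rightarrow> nat \<Rightarrow> nat \<Rightarrow> nat \<Rightarrow> (nat \<Rightarrow> nat) \<Rightarrow> (nat \<Rightarrow> nat) \<Rightarrow> nat \<Rightarrow> bool) \<Rightarrow>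
    state \<Rightarrow> bool" where
  "passing P s \<longleftrightarrow> input s \<and>
     bfs (arr s ''queue'') (arr s ''vis'') (arr s ''par'') (reg s ''st'') (reg s ''tail'') (reg s ''tail'') \<and>
     P (arr s ''queue'') (arr s ''vis'') (arr s ''par'') (reg s ''st'') (reg s ''tail'') (reg s ''root'')
       (arr s ''skip'') (arr s ''color'') (reg s ''j'')"

lemma backward_step:
  assumes s: "passing backward s" and j: "reg s ''st'' < reg s ''j''"
  shows "passing backward (den backward_body s)" "reg (den backward_body s) ''j'' = reg s ''j'' - 1"
    "reg (den backward_body s) ''st'' = reg s ''st''"
proof -
  define Q vis par where "Q = arr s ''queue''" and "vis = arr s ''vis''" and "par = arr s ''par''"
  define st t r where "st = reg s ''st''" and "t = reg s ''tail''" and "r = reg s ''root''"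
  define sk col k where "sk = arr s ''skip''" and "col = arr s ''color''" and "k = reg s ''j'' - 1"
  define u where "u = Q k"
  define s1 where "s1 = set_reg ''u'' u (set_reg ''j'' k s)"
  note defs = Q_def vis_def par_def st_def t_def r_def sk_def col_def
  have i: "input s" and b: "bfs Q vis par st t t" and B: "backward Q vis par st t r sk col (Suc k)" and k: "st \<le> k"
    using s j by (auto simp: passing_def defs k_def)
  have kt: "k < t" using backwardD(3)[OF B] by simp
  have u: "u < n" using bfs_less[OF b kt] by (simp add: u_def)
  have den: "den backward_body s = (if sk k = 0 then den color_next s1 else set_arr ''skip'' (par k) 1 s1)"
    by (simp add: backward_body_def s1_def u_def k_def defs)
  have "passing backward (den backward_body s) \<and> reg (den backward_body s) ''j'' = k \<and> reg (den backward_body s) ''st'' = st"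
  proof (cases "sk k = 0")
    case False
    have "backward Q vis par st t r (sk(par k := 1)) col k"
      by (rule backward_mark[OF b B k False])
    then show ?thesis using i b False by (simp add: den s1_def passing_def input_def flip: defs)
  next
    case True
    have i1: "input s1" "u = reg s1 ''u''" "col = arr s1 ''color''"
      using i by (simp_all add: s1_def input_def col_def)
    have w: "waiting col u" using backward_waiting[OF b B k True] by (simp add: u_def)
    from den_color_next[OF i1(1,2) u i1(3) settled_partial[OF backwardD(1)[OF B]]] w
    consider "den color_next s1 = s1" "col u \<noteq> 0" |
      c d where "col u = 0" "c \<noteq> 0" "d \<noteq> 0" "partial (col(u := c, mate u := d))"
        "den color_next s1 = set_arr ''color'' (mate u) d (set_arr ''color'' u c s1)" by blast
    then show ?thesis
    proof cases
      case 1
      have "backward Q vis par st t r sk col k"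
        by (rule backward_skip[OF B k True]) (use 1 in \<open>simp add: u_def\<close>)
      then show ?thesis using i b True 1 by (simp add: den s1_def passing_def input_def flip: defs)
    next
      case 2
      have "backward Q vis par st t r sk (col(u := c, mate u := d)) k"
        unfolding u_def by (rule backward_color[OF b B k True]) (use 2 in \<open>simp_all add: u_def\<close>)
      then show ?thesis using i b True 2 by (simp add: den s1_def passing_def input_def flip: defs)
    qed
  qed
  then show "passing backward (den backward_body s)" "reg (den backward_body s) ''j'' = reg s ''j'' - 1"
    "reg (den backward_body s) ''st'' = reg s ''st''" by (simp_all add: k_def st_def)
qed

lemma forward_step:
  assumes s: "passing forward s" and j: "reg s ''j'' < reg s ''tail''"
  shows "passing forward (den forward_body s)" "reg (den forward_body s) ''j'' = Suc (reg s ''j'')"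
    "reg (den forward_body s) ''tail'' = reg s ''tail''"
proof -
  define Q vis par where "Q = arr s ''queue''" and "vis = arr s ''vis''" and "par = arr s ''par''"
  define st t r where "st = reg s ''st''" and "t = reg s ''tail''" and "r = reg s ''root''"
  define sk col k where "sk = arr s ''skip''" and "col = arr s ''color''" and "k = reg s ''j''"
  define u where "u = Q k"
  define s1 where "s1 = set_reg ''u'' u s"
  note defs = Q_def vis_def par_def st_def t_def r_def sk_def col_def
  have i: "input s" and b: "bfs Q vis par st t t" and B: "forward Q vis par st t r sk col k" and k: "k < t"
    using s j by (auto simp: passing_def defs k_def)
  have u: "u < n" using bfs_less[OF b k] by (simp add: u_def)
  have den: "den forward_body s = set_reg ''j'' (Suc (reg (den color_next s1) ''j'')) (den color_next s1)"
    by (simp add: forward_body_def s1_def u_def k_def defs)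
  have i1: "input s1" "u = reg s1 ''u''" "col = arr s1 ''color''"
    using i by (simp_all add: s1_def input_def col_def)
  have w: "col u = 0 \<Longrightarrow> rootable col u \<or> waiting col u" using forward_ready[OF b B k] by (simp add: u_def)
  have p: "partial col" using B by (simp add: forward_def settled_def)
  from den_color_next[OF i1(1,2) u i1(3) p w]
  consider "den color_next s1 = s1" "col u \<noteq> 0" |
    c d where "col u = 0" "c \<noteq> 0" "d \<noteq> 0" "partial (col(u := c, mate u := d))"
      "den color_next s1 = set_arr ''color'' (mate u) d (set_arr ''color'' u c s1)" by blast
  then have "passing forward (den forward_body s) \<and> reg (den forward_body s) ''j'' = Suc k \<and>
    reg (den forward_body s) ''tail'' = t"
  proof cases
    case 1
    have "forward Q vis par st t r sk col (Suc k)"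
      by (rule forward_skip[OF B k]) (use 1 in \<open>simp add: u_def\<close>)
    then show ?thesis using i b 1 by (simp add: den s1_def passing_def input_def k_def flip: defs)
  next
    case 2
    have "forward Q vis par st t r sk (col(u := c, mate u := d)) (Suc k)"
      unfolding u_def by (rule forward_color[OF b B k]) (use 2 in \<open>simp_all add: u_def\<close>)
    then show ?thesis using i b 2 by (simp add: den s1_def passing_def input_def k_def flip: defs)
  qed
  then show "passing forward (den forward_body s)" "reg (den forward_body s) ''j'' = Suc (reg s ''j'')"
    "reg (den forward_body s) ''tail'' = reg s ''tail''" by (simp_all add: k_def t_def)
qed

text \<open>Old marks stay in \<open>skip\<close>; only the positions from \<open>tail\<close> on,
  where later components go, must be unmarked.\<close>

definition done_upto :: "state \<Rightarrow> bool" where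
  "done_upto s \<longleftrightarrow> input s \<and> searched (arr s ''queue'') (arr s ''vis'') (reg s ''tail'') \<and>
     settled (arr s ''queue'') (arr s ''vis'') (reg s ''tail'') (arr s ''color'') \<and>
     (\<forall>k. reg s ''tail'' \<le> k \<and> k < n \<longrightarrow> arr s ''skip'' k = 0)"

lemma input_frame:
  assumes "input s" "frame p s s'" "{''n'', ''lambda''} \<inter> wregs p = {}"
    "{''mate'', ''G_off'', ''G_adj''} \<inter> warrs p = {}"
  shows "input s'"
  using assms by (simp add: input_def frame_def)

text \<open>The nodes of the new component were unvisited when it was opened, and unvisited vertices
  are uncolored.\<close>

lemma fresh_component:
  assumes s: "searched Q vis st" "settled Q vis st col"
    and b: "bfs Q' vis' par st t t" and eq: "\<forall>j<st. Q' j = Q j"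
  shows "fresh Q' vis' st t col"
proof -
  have st: "st < t" using bfs_bounds[OF b] by simp
  have "col x = 0" if "x < n" "vis' x = 0" for x
  proof -
    have "\<not> (\<exists>j<st. x \<in> node (Q j))" using bfs_vis[OF b that(1)] that(2) eq st by (metis less_trans)
    then show ?thesis using s that(1) unfolding searched_def settled_def by blast
  qed
  moreover have "col (Q' i) = 0" if i: "st \<le> i" "i < t" for i
  proof -
    have "\<not> (\<exists>j<st. Q' i \<in> node (Q j))"
    proof
      assume "\<exists>j<st. Q' i \<in> node (Q j)"
      then obtain j where j: "j < st" "Q' i \<in> node (Q' j)" using eq by auto
      then show False using bfs_inj[OF b i(2), of j] i st by auto
    qed
    then show ?thesis using s bfs_less[OF b i(2)] unfolding searched_def settled_def by blast
  qed
  ultimately show ?thesis using s(2) eq by (auto simp: fresh_def settled_def)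
qed

lemma exec_component:
  assumes s: "done_upto s" and u: "reg s ''i'' < n" "arr s ''vis'' (reg s ''i'') = 0"
  shows "\<exists>t s'. exec component s t s' \<and> done_upto s' \<and> reg s' ''i'' = reg s ''i'' \<and>
    reg s ''tail'' < reg s' ''tail'' \<and> reg s' ''tail'' \<le> n \<and> arr s' ''vis'' (reg s ''i'') \<noteq> 0 \<and>
    (\<forall>x<n. arr s ''vis'' x \<noteq> 0 \<longrightarrow> arr s' ''vis'' x \<noteq> 0) \<and>
    t \<le> component_cost * (reg s' ''tail'' - reg s ''tail'' + 1)"
proof -
  define st u where "st = reg s ''tail''" and "u = reg s ''i''"
  have i: "input s" and se: "searched (arr s ''queue'') (arr s ''vis'') st"
    and sd: "settled (arr s ''queue'') (arr s ''vis'') st (arr s ''color'')"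
    and sk: "\<forall>k. st \<le> k \<and> k < n \<longrightarrow> arr s ''skip'' k = 0"
    using s by (auto simp: done_upto_def st_def)
  have un: "u < n" "arr s ''vis'' u = 0" using u by (auto simp: u_def)
  define s1 where "s1 = den open_component s"
  have s1: "arr s1 ''queue'' = (arr s ''queue'')(st := u)" "arr s1 ''vis'' = (arr s ''vis'')(u := 1, mate u := 1)"
    "arr s1 ''par'' = (arr s ''par'')(st := st)" "reg s1 ''st'' = st" "reg s1 ''head'' = st" "reg s1 ''tail'' = Suc st"
    "reg s1 ''low'' = 0" "arr s1 ''skip'' = arr s ''skip''" "arr s1 ''color'' = arr s ''color''" "reg s1 ''i'' = u"
    "input s1"
    using i input_mate[OF i un(1)] by (auto simp: s1_def open_component_def enqueue_def st_def u_def input_def)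
  obtain t0 where t0: "exec open_component s t0 s1" "t0 \<le> mcost open_component"
    using exec_den[of open_component s] by (auto simp: s1_def)
  define q where "q = arr s1 ''queue''"
  let ?b1 = "Less (Reg ''head'') (Reg ''tail'')" and ?b2 = "Less (Reg ''st'') (Reg ''j'')"
    and ?b3 = "Less (Reg ''j'') (Reg ''tail'')"
  have "searching q s1"
    using bfs_start[OF se un] by (auto simp: searching_def s1 q_def low_info_def)
  moreover have "searching q (den bfs_body s') \<and> n - reg (den bfs_body s') ''head'' < n - reg s' ''head''"
    if "searching q s'" "bval ?b1 s'" for s'
  proof -
    have "reg s' ''tail'' \<le> n" using that(1) bfs_length unfolding searching_def by blast
    then show ?thesis using searching_step[OF that(1)] that(2) by simp
  qed
  ultimately obtain t1 s2 where t1: "exec (While ?b1 bfs_body) s1 t1 s2" "frame bfs_body s1 s2" "searching q s2"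
    "\<not> bval ?b1 s2"
    "t1 + iter_cost ?b1 bfs_body * (n - reg s2 ''head'') \<le> iter_cost ?b1 bfs_body * (n - reg s1 ''head'' + 1)"
    using exec_While_measure[of bfs_body "searching q" s1 ?b1 "\<lambda>s. n - reg s ''head''"] by auto
  define t where "t = reg s2 ''tail''"
  have r2: "reg s2 ''st'' = st" "reg s2 ''i'' = u" "arr s2 ''skip'' = arr s ''skip''" "arr s2 ''color'' = arr s ''color''"
    using frame_reg[OF t1(2)] frame_arr[OF t1(2)] s1 by (simp_all add: wregs_simps warrs_simps)
  have i2: "input s2" "reg s2 ''head'' = t" and b2: "bfs (arr s2 ''queue'') (arr s2 ''vis'') (arr s2 ''par'') st t t"
    and q2: "\<forall>j\<le>st. arr s2 ''queue'' j = q j"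
    and l2: "low_info (arr s2 ''queue'') st t t (reg s2 ''low'') (reg s2 ''root'')"
  proof -
    have h: "reg s2 ''head'' = t"
      using t1(3,4) bfs_bounds unfolding searching_def t_def by fastforce
    then show "reg s2 ''head'' = t" .
    show "input s2" "bfs (arr s2 ''queue'') (arr s2 ''vis'') (arr s2 ''par'') st t t"
      "\<forall>j\<le>st. arr s2 ''queue'' j = q j" "low_info (arr s2 ''queue'') st t t (reg s2 ''low'') (reg s2 ''root'')"
      using t1(3) unfolding searching_def h r2 t_def[symmetric] by blast+
  qed
  have tn: "t \<le> n" "st < t" using bfs_length[OF b2] bfs_bounds[OF b2] by auto
  \<comment> \<open>The measure was \<open>n - head\<close>, since the final \<open>tail\<close> is
    unknown during the search; its rest \<open>n - t\<close> cancels and leaves a bound in the size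
    of this component.\<close>
  have c1: "t1 \<le> iter_cost ?b1 bfs_body * (t - st + 1)"
  proof -
    have "n - st + 1 = (t - st + 1) + (n - t)" using tn by simp
    then have "iter_cost ?b1 bfs_body * (n - st + 1) = iter_cost ?b1 bfs_body * (t - st + 1) + iter_cost ?b1 bfs_body * (n - t)"
      by (simp only: add_mult_distrib2)
    then show ?thesis using t1(5) i2 s1 by simp
  qed
  have fr: "fresh (arr s2 ''queue'') (arr s2 ''vis'') st t (arr s2 ''color'')"
    unfolding r2 by (rule fresh_component[OF se sd b2]) (use q2 in \<open>auto simp: q_def s1\<close>)
  define s3 where "s3 = den close_component s2"
  obtain t2 where t2: "exec close_component s2 t2 s3" "t2 \<le> mcost close_component"
    using exec_den[of close_component s2] by (auto simp: s3_def)
  have f3: "frame close_component s2 s3" by (simp add: s3_def frame_den)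
  have r3: "reg s3 ''st'' = st" "reg s3 ''tail'' = t" "reg s3 ''i'' = u" "arr s3 ''queue'' = arr s2 ''queue''"
    "arr s3 ''vis'' = arr s2 ''vis''" "arr s3 ''par'' = arr s2 ''par''"
    using frame_reg[OF f3] frame_arr[OF f3] r2 by (simp_all add: wregs_simps warrs_simps t_def)
  have i3: "input s3"
    by (rule input_frame[OF i2(1) f3]) (simp_all add: wregs_simps warrs_simps)
  define s2' where "s2' = den choose_root s2"
  have f2': "frame choose_root s2 s2'" by (simp add: s2'_def frame_den)
  have r2': "reg s2' ''tail'' = t" "arr s2' ''skip'' = arr s ''skip''"
    using frame_reg[OF f2'] frame_arr[OF f2'] r2 by (simp_all add: wregs_simps warrs_simps t_def)
  have "s3 = set_reg ''j'' (reg s2' ''tail'') (set_arr ''skip'' (reg s2' ''root'') 1 s2')"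
    by (simp add: s3_def close_component_def s2'_def)
  then have s3: "reg s3 ''j'' = t" "reg s3 ''root'' = reg s2' ''root''" "arr s3 ''color'' = arr s2' ''color''"
    "arr s3 ''skip'' = (arr s ''skip'')(reg s3 ''root'' := 1)" using r2' by simp_all
  have "plan (arr s3 ''queue'') (arr s3 ''vis'') (arr s3 ''par'') st t (reg s3 ''root'') (arr s3 ''color'')"
    unfolding r3 s3(2,3) s2'_def
    by (rule den_choose_root[OF i2(1) refl refl refl _ _ refl b2 fr l2]) (simp_all add: r2 t_def)
  then have "passing backward s3"
    using backward_start[of "arr s3 ''queue''" "arr s3 ''vis''" "arr s3 ''par''" st t "reg s3 ''root''" "arr s3 ''color''" "arr s ''skip''"]
      b2 sk i3 by (simp add: passing_def r3 s3(1,4))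
  then obtain t3 s4 where t3: "exec (While ?b2 backward_body) s3 t3 s4" "frame backward_body s3 s4" "passing backward s4"
    "\<not> bval ?b2 s4"
    "t3 \<le> iter_cost ?b2 backward_body * (reg s3 ''j'' - reg s3 ''st'' + 1)"
    using exec_While_measure[of backward_body "passing backward" s3 ?b2 "\<lambda>s. reg s ''j'' - reg s ''st''"] backward_step
    by (fastforce dest: add_leD1)
  have r4: "reg s4 ''st'' = st" "reg s4 ''tail'' = t" "reg s4 ''i'' = u" "arr s4 ''queue'' = arr s2 ''queue''"
    "arr s4 ''vis'' = arr s2 ''vis''" "arr s4 ''par'' = arr s2 ''par''"
    using frame_reg[OF t3(2)] frame_arr[OF t3(2)] r3 by (simp_all add: wregs_simps warrs_simps)
  have j4: "reg s4 ''j'' = st" using t3(3,4) backwardD(2) r4 unfolding passing_def by fastforce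
  have "passing forward s4" using t3(3) forward_start[OF b2] by (simp add: passing_def r4 j4)
  then obtain t4 s5 where t4: "exec (While ?b3 forward_body) s4 t4 s5" "frame forward_body s4 s5" "passing forward s5"
    "\<not> bval ?b3 s5"
    "t4 \<le> iter_cost ?b3 forward_body * (reg s4 ''tail'' - reg s4 ''j'' + 1)"
    using exec_While_measure[of forward_body "passing forward" s4 ?b3 "\<lambda>s. reg s ''tail'' - reg s ''j''"] forward_step
    by (fastforce dest: add_leD1)
  have r5: "reg s5 ''st'' = st" "reg s5 ''tail'' = t" "reg s5 ''i'' = u" "arr s5 ''queue'' = arr s2 ''queue''"
    "arr s5 ''vis'' = arr s2 ''vis''" "arr s5 ''par'' = arr s2 ''par''"
    using frame_reg[OF t4(2)] frame_arr[OF t4(2)] r4 by (simp_all add: wregs_simps warrs_simps)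
  have F: "forward (arr s2 ''queue'') (arr s2 ''vis'') (arr s2 ''par'') st t (reg s5 ''root'') (arr s5 ''skip'') (arr s5 ''color'') t"
  proof -
    have "reg s5 ''j'' = t" using t4(3,4) r5 unfolding passing_def forward_def by auto
    then show ?thesis using t4(3) by (simp add: passing_def r5)
  qed
  have "done_upto s5"
    using F t4(3) bfs_searched[OF b2] by (simp add: done_upto_def r5 forward_def passing_def)
  moreover have "arr s5 ''vis'' u \<noteq> 0" "\<forall>x<n. arr s ''vis'' x \<noteq> 0 \<longrightarrow> arr s5 ''vis'' x \<noteq> 0"
  proof -
    have "arr s2 ''queue'' st = u" using q2 by (simp add: q_def s1)
    then have "u \<in> node (arr s2 ''queue'' st)" by (simp add: node_def)
    then show "arr s5 ''vis'' u \<noteq> 0" using bfs_vis[OF b2 un(1)] tn(2) r5 by auto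
    show "\<forall>x<n. arr s ''vis'' x \<noteq> 0 \<longrightarrow> arr s5 ''vis'' x \<noteq> 0"
    proof (intro allI impI)
      fix x assume x: "x < n" "arr s ''vis'' x \<noteq> 0"
      then obtain j where j: "j < st" "x \<in> node (arr s ''queue'' j)" using se unfolding searched_def by blast
      then have "x \<in> node (arr s2 ''queue'' j)" using q2 by (simp add: q_def s1)
      moreover have "j < t" using j(1) tn(2) by simp
      ultimately show "arr s5 ''vis'' x \<noteq> 0" using bfs_vis[OF b2 x(1)] unfolding r5 by blast
    qed
  qed
  moreover have "exec component s (t0 + (t1 + (t2 + (t3 + t4)))) s5"
    unfolding component_def
    by (rule exec.Seq[OF t0(1) exec.Seq[OF t1(1) exec.Seq[OF t2(1) exec.Seq[OF t3(1) t4(1)]]]])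
  moreover have "t0 + (t1 + (t2 + (t3 + t4))) \<le> component_cost * (t - st + 1)"
    using t0(2) t2(2) c1 t3(5) t4(5) unfolding component_cost_def r3 r4 s3(1) j4
    by (simp add: algebra_simps)
  ultimately show ?thesis using r5(2,3) tn unfolding u_def[symmetric] st_def[symmetric]
    by (intro exI[of _ "t0 + (t1 + (t2 + (t3 + t4)))"] exI[of _ s5]) simp
qed

text \<open>The potential counts untested vertices and free queue slots. Each round uses up one
  vertex, and a component uses up one slot per node, which pays for its loops.\<close>

lemma exec_outer_body:
  assumes s: "done_upto s" "reg s ''i'' < n" "\<forall>x<reg s ''i''. arr s ''vis'' x \<noteq> 0"
  shows "\<exists>t s'. exec outer_body s t s' \<and> done_upto s' \<and> reg s' ''i'' \<le> n \<and>
    (\<forall>x<reg s' ''i''. arr s' ''vis'' x \<noteq> 0) \<and>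
    t + bcost (Less (Reg ''i'') (Reg ''n'')) + 1 + outer_cost * ((n - reg s' ''i'') + (n - reg s' ''tail''))
      \<le> outer_cost * ((n - reg s ''i'') + (n - reg s ''tail''))"
proof -
  let ?b = "Equal (Read ''vis'' (Reg ''i'')) (Const 0)"
  have "\<exists>t s'. exec (If ?b component Skip) s t s' \<and> done_upto s' \<and> reg s' ''i'' = reg s ''i'' \<and>
    reg s ''tail'' \<le> reg s' ''tail'' \<and> reg s' ''tail'' \<le> n \<and>
    (\<forall>x\<le>reg s ''i''. arr s' ''vis'' x \<noteq> 0) \<and>
    t \<le> bcost ?b + 2 + 2 * component_cost * (reg s' ''tail'' - reg s ''tail'')"
  proof (cases "arr s ''vis'' (reg s ''i'') = 0")
    case False
    have "reg s ''tail'' \<le> n"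
      using s(1) queue_length[of "reg s ''tail''" "arr s ''queue''"] by (simp add: done_upto_def searched_def)
    then show ?thesis using s False exec.IfFalse[of ?b s Skip 1 s component] exec.Skip[of s]
      by (intro exI[of _ "bcost ?b + 1 + 1"] exI[of _ s]) (auto simp: le_less)
  next
    case True
    from exec_component[OF s(1,2) True] obtain t s' where t: "exec component s t s'" "done_upto s'"
      "reg s' ''i'' = reg s ''i''" "reg s ''tail'' < reg s' ''tail''" "reg s' ''tail'' \<le> n"
      "arr s' ''vis'' (reg s ''i'') \<noteq> 0" "\<forall>x<n. arr s ''vis'' x \<noteq> 0 \<longrightarrow> arr s' ''vis'' x \<noteq> 0"
      "t \<le> component_cost * (reg s' ''tail'' - reg s ''tail'' + 1)" by blast
    have "\<forall>x\<le>reg s ''i''. arr s' ''vis'' x \<noteq> 0"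
      using t(6,7) s(2,3) by (auto simp: le_less)
    moreover have "component_cost * (reg s' ''tail'' - reg s ''tail'' + 1)
        \<le> component_cost * (2 * (reg s' ''tail'' - reg s ''tail''))"
      using t(4) by (intro mult_left_mono) auto
    then have "bcost ?b + 1 + t \<le> bcost ?b + 2 + 2 * component_cost * (reg s' ''tail'' - reg s ''tail'')"
      using t(8) unfolding mult.assoc mult.left_commute[of 2] by linarith
    moreover have "exec (If ?b component Skip) s (bcost ?b + 1 + t) s'"
      by (rule exec.IfTrue) (use True t(1) in simp_all)
    ultimately show ?thesis using t(2-5) by (intro exI[of _ "bcost ?b + 1 + t"] exI[of _ s']) auto
  qed
  then obtain t s' where t: "exec (If ?b component Skip) s t s'" "done_upto s'" "reg s' ''i'' = reg s ''i''"
    "reg s ''tail'' \<le> reg s' ''tail''" "reg s' ''tail'' \<le> n" "\<forall>x\<le>reg s ''i''. arr s' ''vis'' x \<noteq> 0"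
    "t \<le> bcost ?b + 2 + 2 * component_cost * (reg s' ''tail'' - reg s ''tail'')" by blast
  define s'' where "s'' = set_reg ''i'' (Suc (reg s ''i'')) s'"
  have ex: "exec outer_body s (t + (acost (Succ (Reg ''i'')) + 1)) s''"
    unfolding outer_body_def s''_def
    by (rule exec.Seq[OF t(1)]) (use exec.Assign[of "''i''" "Succ (Reg ''i'')" s'] t(3) in simp)
  let ?d = "reg s' ''tail'' - reg s ''tail''"
  have eq: "(n - reg s ''i'') + (n - reg s ''tail'') = (n - Suc (reg s ''i'')) + (n - reg s' ''tail'') + 1 + ?d"
    using s(2) t(4,5) by simp
  have "2 * component_cost * ?d \<le> outer_cost * ?d"
    by (intro mult_right_mono) (simp_all add: outer_cost_def)
  moreover have "bcost ?b + 2 + (acost (Succ (Reg ''i'')) + 1) + bcost (Less (Reg ''i'') (Reg ''n'')) + 1 \<le> outer_cost"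
    by (simp add: outer_cost_def)
  ultimately have "t + (acost (Succ (Reg ''i'')) + 1) + bcost (Less (Reg ''i'') (Reg ''n'')) + 1
      \<le> outer_cost * 1 + outer_cost * ?d"
    using t(7) by linarith
  then have "t + (acost (Succ (Reg ''i'')) + 1) + bcost (Less (Reg ''i'') (Reg ''n'')) + 1 +
      outer_cost * ((n - Suc (reg s ''i'')) + (n - reg s' ''tail''))
      \<le> outer_cost * ((n - reg s ''i'') + (n - reg s ''tail''))"
    unfolding eq add_mult_distrib2 by linarith
  moreover have "done_upto s''" using t(2) by (simp add: done_upto_def s''_def input_def)
  ultimately show ?thesis using ex t(6) s(2)
    by (intro exI[of _ "t + (acost (Succ (Reg ''i'')) + 1)"] exI[of _ s'']) (auto simp: s''_def less_Suc_eq_le)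
qed

lemma exec_main:
  assumes n: "reg s ''n'' = n" and l: "reg s ''lambda'' = lam"
    and adj: "\<forall>x<n. arr s ''G_off'' x \<le> arr s ''G_off'' (x + 1) \<and>
      bij_betw (arr s ''G_adj'') {arr s ''G_off'' x..<arr s ''G_off'' (x + 1)} (N x)"
    and m: "\<forall>x<n. mate x = (if arr s ''H_off'' x < arr s ''H_off'' (Suc x)
      then arr s ''H_adj'' (arr s ''H_off'' x) else x)"
  shows "\<exists>t s'. exec main s t s' \<and> t \<le> main_cost * (n + 1) \<and> partial (arr s' ''color'') \<and>
    (\<forall>x<n. arr s' ''color'' x \<noteq> 0)"
proof -
  let ?b = "Less (Reg ''i'') (Reg ''n'')"
  define s1 where "s1 = set_reg ''tail'' 0 (set_reg ''i'' 0 s)"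
  define I where "I s' \<longleftrightarrow> reg s' ''i'' \<le> n \<and> (\<forall>x<reg s' ''i''. arr s' ''color'' x = 0 \<and> arr s' ''vis'' x = 0 \<and>
    arr s' ''skip'' x = 0 \<and> arr s' ''mate'' x = mate x)" for s' :: state
  have "I s1" by (simp add: I_def s1_def)
  moreover have "I (den init_body s') \<and> n - reg (den init_body s') ''i'' < n - reg s' ''i''"
    if f: "frame init_body s1 s'" and I: "I s'" and b: "bval ?b s'" for s'
  proof -
    have r: "reg s' ''n'' = n" "arr s' ''H_off'' = arr s ''H_off''" "arr s' ''H_adj'' = arr s ''H_adj''"
      using frame_reg[OF f] frame_arr[OF f] n by (simp_all add: wregs_simps warrs_simps s1_def)
    then have i: "reg s' ''i'' < n" using b by simp
    then show ?thesis using I m r by (auto simp: I_def init_body_def less_Suc_eq)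
  qed
  ultimately obtain t1 s2 where t1: "exec (While ?b init_body) s1 t1 s2" "frame init_body s1 s2" "I s2" "\<not> bval ?b s2"
    "t1 + iter_cost ?b init_body * (n - reg s2 ''i'') \<le> iter_cost ?b init_body * (n - reg s1 ''i'' + 1)"
    using exec_While_measure[of init_body I s1 ?b "\<lambda>s. n - reg s ''i''"] by auto
  have r2: "reg s2 ''n'' = n" "reg s2 ''lambda'' = lam" "reg s2 ''tail'' = 0" "arr s2 ''G_off'' = arr s ''G_off''"
    "arr s2 ''G_adj'' = arr s ''G_adj''"
    using frame_reg[OF t1(2)] frame_arr[OF t1(2)] n l by (simp_all add: wregs_simps warrs_simps s1_def)
  have i2: "reg s2 ''i'' = n" using t1(3,4) r2 by (simp add: I_def)
  define s3 where "s3 = set_reg ''i'' 0 s2"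
  define J where "J s' \<longleftrightarrow> done_upto s' \<and> reg s' ''i'' \<le> n \<and> (\<forall>x<reg s' ''i''. arr s' ''vis'' x \<noteq> 0)" for s' :: state
  have z: "arr s2 ''color'' x = 0" "arr s2 ''vis'' x = 0" "arr s2 ''skip'' x = 0" "arr s2 ''mate'' x = mate x"
    if "x < n" for x using t1(3) that unfolding I_def i2 by blast+
  have "J s3"
    using r2 adj z mate_less
    by (simp add: J_def done_upto_def input_def s3_def searched_def settled_def partial_def)
  moreover have "\<exists>t s''. exec outer_body s' t s'' \<and> J s'' \<and>
      t + bcost ?b + 1 + outer_cost * ((n - reg s'' ''i'') + (n - reg s'' ''tail''))
        \<le> outer_cost * ((n - reg s' ''i'') + (n - reg s' ''tail''))"
    if "J s'" "bval ?b s'" for s'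
  proof -
    have "reg s' ''n'' = n" using that(1) by (simp add: J_def done_upto_def input_def)
    then show ?thesis using exec_outer_body[of s'] that unfolding J_def by fastforce
  qed
  ultimately obtain t2 s4 where t2: "exec (While ?b outer_body) s3 t2 s4" "J s4" "\<not> bval ?b s4"
    "t2 + outer_cost * ((n - reg s4 ''i'') + (n - reg s4 ''tail''))
      \<le> outer_cost * ((n - reg s3 ''i'') + (n - reg s3 ''tail'')) + bcost ?b + 1"
    using exec_While_potential[of J ?b outer_body "\<lambda>s. outer_cost * ((n - reg s ''i'') + (n - reg s ''tail''))" s3] by blast
  have d: "done_upto s4" "reg s4 ''i'' = n" using t2(2,3) by (auto simp: J_def done_upto_def input_def)
  have "partial (arr s4 ''color'')" using d(1) by (simp add: done_upto_def settled_def)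
  moreover have "arr s4 ''color'' x \<noteq> 0" if "x < n" for x
  proof -
    have "arr s4 ''vis'' x \<noteq> 0" using t2(2) d(2) that by (simp add: J_def)
    then show ?thesis using settled_searched[of "arr s4 ''queue''" "arr s4 ''vis''" "reg s4 ''tail''" "arr s4 ''color''" x] d(1) that
      by (simp add: done_upto_def)
  qed
  moreover have "exec main s (2 + (2 + (t1 + (2 + t2)))) s4"
  proof -
    have a: "exec (Assign x (Const 0)) s 2 (set_reg x 0 s)" for x s using exec.Assign[of x "Const 0" s] by (simp add: numeral_2_eq_2)
    show ?thesis unfolding main_def
      by (rule exec.Seq[OF a exec.Seq[OF a exec.Seq[OF t1(1)[unfolded s1_def]
        exec.Seq[OF a t2(1)[unfolded s3_def]]]]])
  qed
  moreover have "2 + (2 + (t1 + (2 + t2))) \<le> main_cost * (n + 1)"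
  proof -
    have "t1 \<le> iter_cost ?b init_body * (n + 1)" using t1(5) by (simp add: s1_def)
    moreover have "t2 \<le> outer_cost * (n + n) + bcost ?b + 1" using t2(4) r2 by (simp add: s3_def)
    ultimately show ?thesis unfolding main_cost_def by (simp add: algebra_simps)
  qed
  ultimately show ?thesis by blast
qed

end

section \<open>Graphs and their encodings\<close>

lemma graph_edge:
  assumes "is_graph G" "{u, v} \<in> edges G"
  shows "u \<in> verts G" "v \<in> verts G" "u \<noteq> v"
proof -
  obtain x y where "{u, v} = {x, y}" "x \<in> verts G" "y \<in> verts G" "x \<noteq> y"
    using assms unfolding is_graph_def by blast
  then show "u \<in> verts G" "v \<in> verts G" "u \<noteq> v" by (auto simp: doubleton_eq_iff)
qed

definition nbrs :: "'a list \<Rightarrow> 'a set set \<Rightarrow> nat \<Rightarrow> nat set" where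
  "nbrs vs E i = {j. j < length vs \<and> {vs ! i, vs ! j} \<in> E}"

lemma finite_nbrs [simp]: "finite (nbrs vs E i)"
  by (simp add: nbrs_def)

lemma nbrs_commute: "i < length vs \<Longrightarrow> j \<in> nbrs vs E i \<Longrightarrow> i \<in> nbrs vs E j"
  by (simp add: nbrs_def insert_commute)

text \<open>Distinct neighbors give distinct edges at the vertex.\<close>

lemma card_nbrs_le_degree:
  assumes G: "is_graph G" and vs: "distinct vs" "set vs = verts G" and i: "i < length vs"
  shows "card (nbrs vs (edges G) i) \<le> degree G (vs ! i)"
  unfolding degree_def
proof (rule card_inj_on_le)
  show "inj_on (\<lambda>j. {vs ! i, vs ! j}) (nbrs vs (edges G) i)"
    using vs(1) by (auto simp: inj_on_def nbrs_def doubleton_eq_iff nth_eq_iff_index_eq)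
  show "(\<lambda>j. {vs ! i, vs ! j}) ` nbrs vs (edges G) i \<subseteq> {e \<in> edges G. vs ! i \<in> e}"
    by (auto simp: nbrs_def)
  have "edges G \<subseteq> Pow (verts G)" "finite (verts G)" using G unfolding is_graph_def by blast+
  then have "finite (edges G)" using finite_subset by auto
  then show "finite {e \<in> edges G. vs ! i \<in> e}" by simp
qed

lemma degree_le_max: "is_graph G \<Longrightarrow> v \<in> verts G \<Longrightarrow> degree G v \<le> max_degree G"
  by (simp add: max_degree_def is_graph_def)

lemma adjacency_lists_nbrs:
  "adjacency_lists off adj vs G \<longleftrightarrow> distinct vs \<and> set vs = verts G \<and> off 0 = 0 \<and>
     (\<forall>i<length vs. off i \<le> off (i + 1) \<and> bij_betw adj {off i..<off (i + 1)} (nbrs vs (edges G) i))"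
  by (simp add: adjacency_lists_def nbrs_def)

text \<open>The neighbor sets are laid out one after the other, so \<open>off\<close> consists of
  the partial sums of their sizes.\<close>

lemma ex_adjacency_lists:
  assumes "distinct vs" "set vs = verts G"
  shows "\<exists>off adj. adjacency_lists off adj vs G"
proof -
  let ?P = "nbrs vs (edges G)"
  define off where "off i = (\<Sum>k<i. card (?P k))" for i
  have mono: "off i \<le> off j" if "i \<le> j" for i j
    unfolding off_def using that by (intro sum_mono2) auto
  have "\<exists>f. bij_betw f {off i..<off (Suc i)} (?P i)" for i
    by (intro finite_same_card_bij) (auto simp: off_def)
  then obtain f where f: "bij_betw (f i) {off i..<off (Suc i)} (?P i)" for i by metis
  \<comment> \<open>The least \<open>i\<close> with \<open>m < off (Suc i)\<close> is the block
    containing position \<open>m\<close>; empty blocks are passed over.\<close>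
  define adj where "adj m = f (LEAST i. m < off (Suc i)) m" for m
  have "bij_betw adj {off i..<off (Suc i)} (?P i)" for i
  proof -
    have "adj m = f i m" if m: "m \<in> {off i..<off (Suc i)}" for m
    proof -
      have "(LEAST i. m < off (Suc i)) = i"
      proof (rule Least_equality)
        fix y assume y: "m < off (Suc y)"
        show "i \<le> y"
        proof (rule ccontr)
          assume "\<not> i \<le> y"
          then have "off (Suc y) \<le> off i" by (intro mono) simp
          then show False using y m by simp
        qed
      qed (use m in simp)
      then show ?thesis by (simp add: adj_def)
    qed
    then show ?thesis using f[of i] bij_betw_cong by metis
  qed
  then have "adjacency_lists off adj vs G"
    using assms mono by (simp add: adjacency_lists_nbrs) (simp add: off_def)
  then show ?thesis by blast
qed

text \<open>The bound on \<open>BBC\<close> comes from running the program, which takes some memory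
  encoding the graph.\<close>

lemma ex_encodes_input:
  assumes "is_graph G"
  shows "\<exists>s vs. encodes_input s vs G (spanned_by G M) lam"
proof -
  obtain vs where vs: "set vs = verts G" "distinct vs"
    using assms finite_distinct_list unfolding is_graph_def by blast
  obtain off adj where G: "adjacency_lists off adj vs G" using ex_adjacency_lists[of vs G] vs by blast
  obtain off' adj' where H: "adjacency_lists off' adj' vs (spanned_by G M)"
    using ex_adjacency_lists[of vs "spanned_by G M"] vs by (auto simp: spanned_by_def)
  define s where "s = \<lparr>reg = (\<lambda>_. 0)(''n'' := length vs, ''lambda'' := lam),
    arr = (\<lambda>_ _. 0)(''G_off'' := off, ''G_adj'' := adj, ''H_off'' := off', ''H_adj'' := adj')\<rparr>"
  have "encodes_input s vs G (spanned_by G M) lam"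
    using G H by (simp add: encodes_input_def s_def)
  then show ?thesis by blast
qed

lemma matching_nbrs_unique:
  assumes "is_graph G" "matching G M" "distinct vs" "i < length vs" "j \<in> nbrs vs M i" "k \<in> nbrs vs M i"
  shows "j = k"
proof -
  have e: "{vs ! i, vs ! j} \<in> M" "{vs ! i, vs ! k} \<in> M" "j < length vs" "k < length vs"
    using assms(5,6) by (auto simp: nbrs_def)
  have "{vs ! i, vs ! j} = {vs ! i, vs ! k}"
  proof (rule ccontr)
    assume "{vs ! i, vs ! j} \<noteq> {vs ! i, vs ! k}"
    then have "disjnt {vs ! i, vs ! j} {vs ! i, vs ! k}"
      using assms(2) e(1,2) unfolding matching_def by (intro pairwiseD[of disjnt M]) auto
    then show False by (simp add: disjnt_def)
  qed
  then have "vs ! j = vs ! k" by (auto simp: doubleton_eq_iff)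
  then show ?thesis using assms(3) e by (simp add: nth_eq_iff_index_eq)
qed

text \<open>The value that \<open>init_body\<close> stores in \<open>mate\<close>, read off the
  initial memory.\<close>

definition partner :: "state \<Rightarrow> nat \<Rightarrow> nat" where
  "partner s x = (if arr s ''H_off'' x < arr s ''H_off'' (Suc x) then arr s ''H_adj'' (arr s ''H_off'' x) else x)"

lemma partner_nbrs:
  assumes "adjacency_lists (arr s ''H_off'') (arr s ''H_adj'') vs (spanned_by G M)" "x < length vs"
  shows "partner s x \<in> nbrs vs M x \<or> partner s x = x \<and> nbrs vs M x = {}"
  using assms bij_betw_apply[of "arr s ''H_adj''" "{arr s ''H_off'' x..<arr s ''H_off'' (Suc x)}" "nbrs vs M x" "arr s ''H_off'' x"]
  by (auto simp: adjacency_lists_nbrs partner_def spanned_by_def bij_betw_def)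

text \<open>\<open>partner\<close> is an involution: \<open>x\<close> is a matching neighbor of its
  partner, and in a matching there is only one.\<close>

lemma backbone_graph_encoding:
  assumes G: "is_graph G" "max_degree G \<le> 4" "matching G M" "3 \<le> lam"
    and s: "encodes_input s vs G (spanned_by G M) lam"
  shows "backbone_graph (length vs) (nbrs vs (edges G)) (partner s) lam"
proof -
  have vs: "distinct vs" "set vs = verts G"
    and H: "adjacency_lists (arr s ''H_off'') (arr s ''H_adj'') vs (spanned_by G M)"
    using s by (auto simp: encodes_input_def adjacency_lists_def)
  have ME: "nbrs vs M x \<subseteq> nbrs vs (edges G) x" for x using G(3) by (auto simp: nbrs_def matching_def)
  show ?thesis
  proof
    fix x assume x: "x < length vs"
    show "card (nbrs vs (edges G) x) \<le> 4"
      using card_nbrs_le_degree[OF G(1) vs x] degree_le_max[OF G(1), of "vs ! x"] G(2) x vs(2) by force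
    show "x \<notin> nbrs vs (edges G) x" using graph_edge(3)[OF G(1), of "vs ! x" "vs ! x"] unfolding nbrs_def by blast
    show "partner s x \<noteq> x \<Longrightarrow> partner s x \<in> nbrs vs (edges G) x" using partner_nbrs[OF H x] ME by blast
    show "partner s (partner s x) = x"
    proof (cases "partner s x = x")
      case False
      then have p: "partner s x \<in> nbrs vs M x" using partner_nbrs[OF H x] by blast
      then have pl: "partner s x < length vs" and xp: "x \<in> nbrs vs M (partner s x)"
        using nbrs_commute[OF x] by (auto simp: nbrs_def)
      then show ?thesis using partner_nbrs[OF H pl] matching_nbrs_unique[OF G(1,3) vs(1) pl] by blast
    qed simp
  next
    fix x y assume "x < length vs" "y \<in> nbrs vs (edges G) x"
    then show "y < length vs" "x \<in> nbrs vs (edges G) y" using nbrs_commute by (auto simp: nbrs_def)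
  qed (rule G(4))
qed

section \<open>From the final memory to a backbone coloring\<close>

lemma exec_main_coloring:
  assumes G: "is_graph G" "max_degree G \<le> 4" "matching G M" "3 \<le> lam"
    and s: "encodes_input s vs G (spanned_by G M) lam"
  shows "\<exists>t s' c. exec main s t s' \<and> t \<le> main_cost * (card (verts G) + 1) \<and>
    encodes_coloring s' vs c \<and> backbone_k_coloring lam (lam + 3) G (spanned_by G M) c"
proof -
  interpret backbone_graph "length vs" "nbrs vs (edges G)" "partner s" lam
    by (rule backbone_graph_encoding[OF G s])
  have vs: "distinct vs" "set vs = verts G" "card (verts G) = length vs"
    and H: "adjacency_lists (arr s ''H_off'') (arr s ''H_adj'') vs (spanned_by G M)"
    using s distinct_card[of vs] by (auto simp: encodes_input_def adjacency_lists_def)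
  obtain t s' where t: "exec main s t s'" "t \<le> main_cost * (length vs + 1)" "partial (arr s' ''color'')"
    "\<forall>x<length vs. arr s' ''color'' x \<noteq> 0"
    using exec_main[of s] s by (auto simp: encodes_input_def adjacency_lists_nbrs partner_def)
  \<comment> \<open>Colors are stored by position; distinctness of \<open>vs\<close> makes the
    inverse of indexing recover the position.\<close>
  define c where "c v = arr s' ''color'' (inv_into {..<length vs} ((!) vs) v)" for v
  have c: "c (vs ! i) = arr s' ''color'' i" if "i < length vs" for i
    using that inj_on_nth[OF vs(1), of "{..<length vs}"] by (simp add: c_def inv_into_f_f)
  have idx: "\<exists>i<length vs. v = vs ! i" if "v \<in> verts G" for v
    using that vs(2) by (metis in_set_conv_nth)
  have col: "arr s' ''color'' i \<in> palette" "\<forall>j\<in>nbrs vs (edges G) i. arr s' ''color'' j \<noteq> arr s' ''color'' i"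
    "partner s i \<noteq> i \<Longrightarrow> far (arr s' ''color'' i) (arr s' ''color'' (partner s i))" if "i < length vs" for i
    using t(3,4) that unfolding partial_def by blast+
  have range: "c v \<in> {1..lam + 3}" if "v \<in> verts G" for v
    using idx[OF that] c col(1) by (fastforce simp: palette_def)
  have proper: "c u \<noteq> c v" if e: "{u, v} \<in> edges G" for u v
  proof -
    obtain i j where ij: "i < length vs" "j < length vs" "u = vs ! i" "v = vs ! j"
      using idx graph_edge[OF G(1) e] by metis
    then have "j \<in> nbrs vs (edges G) i" using e by (simp add: nbrs_def)
    then show ?thesis using col(2)[OF ij(1)] c ij by metis
  qed
  have backbone: "int lam \<le> \<bar>int (c u) - int (c v)\<bar>" if e: "{u, v} \<in> M" for u v
  proof -
    have eG: "{u, v} \<in> edges G" using e G(3) by (auto simp: matching_def)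
    obtain i j where ij: "i < length vs" "j < length vs" "u = vs ! i" "v = vs ! j"
      using idx graph_edge[OF G(1) eG] by metis
    have j: "j \<in> nbrs vs M i" using e ij by (simp add: nbrs_def)
    then have "partner s i = j"
      using partner_nbrs[OF H ij(1)] matching_nbrs_unique[OF G(1,3) vs(1) ij(1)] by blast
    moreover have "j \<noteq> i" using graph_edge(3)[OF G(1) eG] ij by auto
    ultimately have "far (c u) (c v)" using col(3)[OF ij(1)] c ij by simp
    then show ?thesis by (auto simp: far_def)
  qed
  have "backbone_k_coloring lam (lam + 3) G (spanned_by G M) c"
    using range proper backbone by (auto simp: backbone_k_coloring_def backbone_coloring_def spanned_by_def)
  moreover have "encodes_coloring s' vs c" using c by (simp add: encodes_coloring_def)
  ultimately show ?thesis using t(1,2) vs(3) by auto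
qed

theorem theorem11:
  "(\<forall>(G :: 'a graph) M lam.
      is_graph G \<and> max_degree G \<le> 4 \<and> matching G M \<and> 3 \<le> lam \<longrightarrow>
      BBC lam G (spanned_by G M) \<le> lam + 3) \<and>
   (\<exists>p (T :: nat \<Rightarrow> nat).
      (\<lambda>n. real (T n)) \<in> O(\<lambda>n. real n) \<and>
      (\<forall>(G :: 'a graph) M lam vs s.
         is_graph G \<and> max_degree G \<le> 4 \<and> matching G M \<and> 3 \<le> lam \<and>
         encodes_input s vs G (spanned_by G M) lam \<longrightarrow>
         (\<exists>t s' c. exec p s t s' \<and> t \<le> T (card (verts G)) \<and>
            encodes_coloring s' vs c \<and>
            backbone_k_coloring lam (lam + 3) G (spanned_by G M) c)))"
proof (intro conjI)
  show "\<forall>(G :: 'a graph) M lam.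
      is_graph G \<and> max_degree G \<le> 4 \<and> matching G M \<and> 3 \<le> lam \<longrightarrow>
      BBC lam G (spanned_by G M) \<le> lam + 3"
  proof (intro allI impI)
    fix G :: "'a graph" and M and lam :: nat
    assume G: "is_graph G \<and> max_degree G \<le> 4 \<and> matching G M \<and> 3 \<le> lam"
    then obtain s vs where "encodes_input s vs G (spanned_by G M) lam" using ex_encodes_input by blast
    then have "\<exists>c. backbone_k_coloring lam (lam + 3) G (spanned_by G M) c"
      using exec_main_coloring G by blast
    then show "BBC lam G (spanned_by G M) \<le> lam + 3" unfolding BBC_def by (rule Least_le)
  qed
  \<comment> \<open>The summand 1 covers the constant cost on the empty graph; from
    \<open>n = 1\<close> on, \<open>n + 1 \<le> 2 * n\<close>.\<close>
  have "(\<lambda>n. real (main_cost * (n + 1))) \<in> O(\<lambda>n. real n)"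
  proof (rule bigoI)
    show "\<forall>\<^sub>F n in sequentially. norm (real (main_cost * (n + 1))) \<le> real (2 * main_cost) * norm (real n)"
    proof (rule eventually_sequentiallyI[of 1])
      fix n :: nat assume "1 \<le> n"
      then have "main_cost * (n + 1) \<le> main_cost * (2 * n)" by (intro mult_left_mono) auto
      then have "real (main_cost * (n + 1)) \<le> real (2 * main_cost * n)"
        by (intro of_nat_mono) (simp add: mult.assoc mult.left_commute)
      then show "norm (real (main_cost * (n + 1))) \<le> real (2 * main_cost) * norm (real n)" by simp
    qed
  qed
  then show "\<exists>p (T :: nat \<Rightarrow> nat).
      (\<lambda>n. real (T n)) \<in> O(\<lambda>n. real n) \<and>
      (\<forall>(G :: 'a graph) M lam vs s.
         is_graph G \<and> max_degree G \<le> 4 \<and> matching G M \<and> 3 \<le> lam \<and>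
         encodes_input s vs G (spanned_by G M) lam \<longrightarrow>
         (\<exists>t s' c. exec p s t s' \<and> t \<le> T (card (verts G)) \<and>
            encodes_coloring s' vs c \<and>
            backbone_k_coloring lam (lam + 3) G (spanned_by G M) c))"
    using exec_main_coloring by (intro exI[of _ main] exI[of _ "\<lambda>n. main_cost * (n + 1)"]) blast
qed

end
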